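(* For a prime $p$, let $F(p)$ denote the number of pairs $(g,h)$ with $g,h\in\{1,\ldots,p-1\}$ such that $g^{h}\equiv h \pmod p$. Then there exist a constant $c>0$ and $x_0$ such that for all $x\ge x_0$ there are at least $c\,x/\ln x$ primes $p\le x$ with \[ F(p)=(p-1)+O\left(p^{5/6}\right). \] More specifically, there exist a constant $c>0$ and $x_0$ such that for all $x\ge x_0$ there are at least $c\,x/\ln x$ primes $p\le x$ with \[ \left|F(p)-(p-1)\right|\le p^{0.8313}\, d(p-1)^{2}\,(2+\ln p). \]
   Context: $d(n)$ denotes the number of positive divisors of $n$. The implied constant in the $O$-term is absolute. *)

theory Defs
  imports Complex_Main "HOL-Number_Theory.Number_Theory"
begin

definition F :: "nat \<Rightarrow> nat" where
  "F p = card {(g, h). g \<in> {1..p - 1} \<and> h \<in> {1..p - 1} \<and> [g ^ h = h] (mod p)}"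

definition divisor_count :: "nat \<Rightarrow> nat" where
  "divisor_count n = card {k. k dvd n}"

end

theory Submission
  imports Defs "HOL-Analysis.Convex" "HOL-Real_Asymp.Real_Asymp"
begin

text \<open>
  Fix \<open>h\<close>, let \<open>e = gcd h (p - 1)\<close> and \<open>p - 1 = e m\<close>. The congruence \<open>g^h = h\<close> has \<open>e\<close> solutions \<open>g\<close> if
  \<open>h^m = 1\<close> modulo \<open>p\<close> and none otherwise, so \<open>F p\<close> is the sum of \<open>e N(m)\<close> over \<open>m\<close> dividing \<open>p - 1\<close>, where \<open>N(m)\<close>
  counts the \<open>j \<le> m\<close> coprime to \<open>m\<close> with \<open>(e j)^m = 1\<close>. As the \<open>totient m\<close> sum to \<open>p - 1\<close>, it suffices to
  compare \<open>e N(m)\<close> with \<open>totient m\<close>.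

  If \<open>m\<close> is large, completing the sum over \<open>j\<close> and bounding exponential sums over the subgroup of \<open>m\<close>-th
  roots of unity gives an asymptotic formula. For medium \<open>m\<close> an upper bound for \<open>N(m)\<close> suffices: all products of
  \<open>k\<close> of the numbers \<open>j\<close> lie in one coset of that subgroup, so by the divisor bound \<open>N(m)^k\<close> is at most
  \<open>m (m^k / p + 1)\<close> up to a small power of \<open>p\<close>; near \<open>m = p^(2/3)\<close> this is used on the dual side, to show that few
  small frequencies share a coset. For \<open>m \<le> p^0.3\<close>, \<open>N(m) \<noteq> 0\<close> forces \<open>p\<close> to divide one of the nonzero numbers
  \<open>(-j)^m - m^m\<close>, which happens for \<open>O(x^0.9 ln x)\<close> primes up to \<open>x\<close> only. Thus the estimate holds for almost all
  primes and no information on large prime factors of \<open>p - 1\<close> is needed.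
\<close>

section \<open>Divisor bound\<close>

lemma divisor_count_pos: "n > 0 \<Longrightarrow> divisor_count n \<ge> 1"
  unfolding divisor_count_def
  by (metis (mono_tags, lifting) One_nat_def Suc_leI card_gt_0_iff dvd_refl empty_iff finite_divisors_nat mem_Collect_eq)

text \<open>A divisor of \<open>x * y\<close> is a product of divisors of the two factors, so the
  pairs of divisors cover the divisors of the product.\<close>

lemma divisor_count_mult_le:
  assumes "x > 0" "y > 0"
  shows "divisor_count (x * y) \<le> divisor_count x * divisor_count y"
proof -
  have "{k. k dvd x * y} \<subseteq> (\<lambda>(a, b). a * b) ` ({k. k dvd x} \<times> {k. k dvd y})"
  proof
    fix k assume "k \<in> {k. k dvd x * y}"
    then obtain a b where "k = a * b" "a dvd x" "b dvd y" using division_decomp[of k x y] by auto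
    thus "k \<in> (\<lambda>(a, b). a * b) ` ({k. k dvd x} \<times> {k. k dvd y})"
      by (intro image_eqI[of _ _ "(a, b)"]) auto
  qed
  hence "card {k. k dvd x * y} \<le> card ((\<lambda>(a, b). a * b) ` ({k. k dvd x} \<times> {k. k dvd y}))"
    using assms by (intro card_mono) auto
  also have "\<dots> \<le> card ({k. k dvd x} \<times> {k. k dvd y})"
    using assms by (intro card_image_le) auto
  finally show ?thesis
    by (simp add: divisor_count_def card_cartesian_product)
qed

lemma divisor_count_prime_power_le:
  assumes "prime (q::nat)"
  shows "divisor_count (q ^ a) \<le> a + 1"
proof -
  have "{k. k dvd q ^ a} \<subseteq> (\<lambda>i. q ^ i) ` {..a}"
    using assms by (auto simp: divides_primepow_nat image_iff)
  hence "card {k. k dvd q ^ a} \<le> card ((\<lambda>i. q ^ i) ` {..a})"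
    by (intro card_mono) auto
  also have "\<dots> \<le> a + 1"
    using card_image_le[of "{..a}"] by simp
  finally show ?thesis by (simp add: divisor_count_def)
qed

text \<open>Each prime below a bound \<open>P\<close> with \<open>P powr \<epsilon> \<ge> 2\<close> costs a constant factor, all others cost nothing.\<close>
lemma divisor_count_le_powr:
  assumes "\<epsilon> > (0::real)"
  shows "\<exists>C\<ge>1. \<forall>n>0. real (divisor_count n) \<le> C * real n powr \<epsilon>"
proof -
  \<comment> \<open>\<open>B * \<epsilon> * ln 2 \<ge> 1\<close> makes
    \<open>a + 1 \<le> B * (1 + a * \<epsilon> * ln 2)\<close>, to which
    \<open>1 + y \<le> exp y\<close> applies. The maximum with 1 allows the exponent of
    \<open>B\<close> to be increased later.\<close>
  define B :: real where "B = max 1 (1 / (\<epsilon> * ln 2))"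
  have B1: "B \<ge> 1" by (simp add: B_def)
  obtain P :: nat where P: "real P > 2 powr (1 / \<epsilon>)" using reals_Archimedean2 by blast
  have small: "real a + 1 \<le> B * real q powr (real a * \<epsilon>)" if "q \<ge> 2" for a q :: nat
  proof -
    have "\<epsilon> * ln 2 > 0" using assms by simp
    have "1 / (\<epsilon> * ln 2) \<le> B" unfolding B_def by (rule max.cobounded2)
    hence "1 \<le> B * (\<epsilon> * ln 2)"
      using \<open>\<epsilon> * ln 2 > 0\<close> by (simp only: pos_divide_le_eq)
    hence "real a * 1 \<le> real a * (B * (\<epsilon> * ln 2))" by (intro mult_left_mono) auto
    hence "real a + 1 \<le> B * (1 + real a * \<epsilon> * ln 2)"
      using B1 by (simp add: algebra_simps)
    also have "\<dots> \<le> B * exp (real a * \<epsilon> * ln 2)"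
      using B1 by (intro mult_left_mono exp_ge_add_one_self) auto
    also have "exp (real a * \<epsilon> * ln 2) = 2 powr (real a * \<epsilon>)" by (simp add: powr_def)
    also have "B * 2 powr (real a * \<epsilon>) \<le> B * real q powr (real a * \<epsilon>)"
      using B1 assms that by (intro mult_left_mono powr_mono2) auto
    finally show ?thesis .
  qed
  have large: "real a + 1 \<le> real q powr (real a * \<epsilon>)" if "q > P" for a q :: nat
  proof -
    have "2 = (2 powr (1 / \<epsilon>)) powr \<epsilon>" using assms by (simp add: powr_powr)
    also have "\<dots> \<le> real q powr \<epsilon>" using that P assms by (intro powr_mono2) auto
    finally have "2 ^ a \<le> (real q powr \<epsilon>) ^ a" by (intro power_mono) auto
    also have "(real q powr \<epsilon>) ^ a = (real q powr \<epsilon>) powr real a"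
      using that by (intro powr_realpow[symmetric]) simp
    also have "\<dots> = real q powr (real a * \<epsilon>)" by (simp add: powr_powr mult.commute)
    finally have "2 ^ a \<le> real q powr (real a * \<epsilon>)" .
    moreover have "real a + 1 \<le> 2 ^ a"
    proof -
      have "real (Suc a) \<le> real (2 ^ a)" by (rule of_nat_mono) (rule Suc_leI[OF less_exp])
      thus ?thesis by simp
    qed
    ultimately show ?thesis by linarith
  qed
  \<comment> \<open>Splitting off a full prime power \<open>q ^ a\<close> costs one factor
    \<open>B\<close> exactly when \<open>q \<le> P\<close>. The exponent records these primes and is
    at most \<open>P + 1\<close> whatever \<open>n\<close> is.\<close>
  have "real (divisor_count n) \<le> B ^ card (prime_factors n \<inter> {..P}) * real n powr \<epsilon>" if "n > 0" for n
    using that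
  proof (induction n rule: less_induct)
    case (less n)
    show ?case
    proof (cases "n = 1")
      case True
      have "{k::nat. k = Suc 0} = {Suc 0}" by auto
      with True show ?thesis by (simp add: divisor_count_def)
    next
      case False
      then obtain q where q: "prime q" "q dvd n" using prime_factor_nat by blast
      define a where "a = multiplicity q n"
      obtain k where k: "n = q ^ a * k" "\<not> q dvd k"
        using multiplicity_decompose'[of n q] q less.prems not_prime_unit[of q] unfolding a_def by blast
      have a: "a > 0" using k q by (intro Nat.gr0I) auto
      have k0: "k > 0" using k less.prems by (cases k) auto
      have q2: "q \<ge> 2" using q prime_ge_2_nat by blast
      have "1 < q ^ a" using q2 a by (intro one_less_power) auto
      hence "k * 1 < k * q ^ a" using k0 by (intro mult_strict_left_mono) auto
      hence "k < n" using k by (simp add: mult.commute)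
      note IH = less.IH[OF this k0]
      define c where "c = card (prime_factors k \<inter> {..P})"
      have pf: "prime_factors n = insert q (prime_factors k)"
        using k(1) k0 q a by (simp add: prime_factors_product prime_factors_power prime_prime_factors)
      have qk: "q \<notin> prime_factors k" using k by auto
      have "real (divisor_count n) \<le> real (divisor_count (q ^ a)) * real (divisor_count k)"
        using divisor_count_mult_le[of "q ^ a" k] k0 q2 unfolding k(1) of_nat_mult[symmetric]
        by (intro of_nat_mono) auto
      also have "\<dots> \<le> (real a + 1) * (B ^ c * real k powr \<epsilon>)"
        using IH divisor_count_prime_power_le[OF q(1), of a] unfolding c_def
        by (intro mult_mono) (auto simp del: of_nat_Suc)
      also have "\<dots> \<le> B ^ card (prime_factors n \<inter> {..P}) * real n powr \<epsilon>"
      proof -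
        have n_eq: "real n powr \<epsilon> = real q powr (real a * \<epsilon>) * real k powr \<epsilon>"
          using k0 q2 by (subst k(1)) (simp add: powr_mult powr_powr flip: powr_realpow)
        have nn: "0 \<le> B ^ c * real k powr \<epsilon>" using B1 by simp
        show ?thesis
        proof (cases "q \<le> P")
          case True
          hence c: "card (prime_factors n \<inter> {..P}) = Suc c" using qk unfolding pf c_def by simp
          show ?thesis
            using mult_right_mono[OF small[OF q2, of a] nn] unfolding n_eq c by (simp only: power_Suc mult_ac)
        next
          case False
          hence c: "card (prime_factors n \<inter> {..P}) = c" unfolding pf c_def by (intro arg_cong[where f = card]) auto
          have "P < q" using False by simp
          show ?thesis
            using mult_right_mono[OF large[OF \<open>P < q\<close>, of a] nn] unfolding n_eq c by (simp only: mult_ac)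
        qed
      qed
      finally show ?thesis .
    qed
  qed
  moreover have "B ^ card (prime_factors n \<inter> {..P}) * real n powr \<epsilon> \<le> B ^ (P + 1) * real n powr \<epsilon>" for n
  proof -
    have "card (prime_factors n \<inter> {..P}) \<le> card {..P}" by (intro card_mono) auto
    thus ?thesis using B1 by (intro mult_right_mono power_increasing) auto
  qed
  ultimately have "\<forall>n>0. real (divisor_count n) \<le> B ^ (P + 1) * real n powr \<epsilon>"
    by (meson order_trans)
  thus ?thesis using B1 one_le_power by blast
qed

section \<open>Chebyshev's lower bound\<close>

text \<open>The Beta integral identity \<open>\<beta> m n = \<beta> m (n-1) - \<beta> (m+1) n\<close> for \<open>\<beta> m n = 1 / (m * (n choose m))\<close>.\<close>
lemma mult_choose_dvd_Lcm:
  assumes "1 \<le> m" "m \<le> n"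
  shows "m * (n choose m) dvd Lcm {1..n}"
proof -
  \<comment> \<open>Integrality of the real quotient is proved by induction on
    \<open>k = n - m\<close>: the recurrence expresses the value at \<open>(m, n)\<close> by those
    at \<open>(m, n - 1)\<close> and \<open>(m + 1, n)\<close>, both of which have a smaller
    difference.\<close>
  have "\<exists>c::int. real (Lcm {1..n}) / (real m * real (n choose m)) = of_int c"
    if "1 \<le> m" "n = m + k" for m n k
    using that
  proof (induction k arbitrary: m n)
    case 0
    have "m dvd Lcm {1..m}" using 0 by (intro dvd_Lcm) auto
    then obtain c where c: "Lcm {1..m} = m * c" by (elim dvdE)
    have "real (Lcm {1..n}) / (real m * real (n choose m)) = of_int (int c)"
      using 0 c by simp
    thus ?case by blast
  next
    case (Suc k)
    obtain c1 where c1: "real (Lcm {1..m + k}) / (real m * real ((m + k) choose m)) = of_int c1"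
      using Suc.IH[of m "m + k"] Suc.prems by auto
    obtain c2 where c2: "real (Lcm {1..n}) / (real (m + 1) * real (n choose (m + 1))) = of_int c2"
      using Suc.IH[of "m + 1" n] Suc.prems by auto
    have "Lcm {1..m + k} dvd Lcm {1..n}" using Suc.prems by (intro Lcm_subset) auto
    then obtain d where d: "Lcm {1..n} = Lcm {1..m + k} * d" by (elim dvdE)
    have e1: "real (Suc k) * real (n choose m) = real n * real ((m + k) choose m)"
      using binomial_absorb_comp[of n m] Suc.prems
      by (metis add_Suc_right add_diff_cancel_left' diff_Suc_1 of_nat_mult)
    have e2: "real (m + 1) * real (n choose (m + 1)) = real (Suc k) * real (n choose m)"
      using binomial_absorption[of m n] binomial_absorb_comp[of n m] Suc.prems
      by (metis Suc_eq_plus1 add_diff_cancel_left' of_nat_mult)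
    have pos: "real (n choose m) > 0" "real ((m + k) choose m) > 0" using Suc.prems by (auto simp: zero_less_binomial)
    have "1 / (real m * real (n choose m)) =
          1 / (real m * real ((m + k) choose m)) - 1 / (real (m + 1) * real (n choose (m + 1)))"
    proof -
      have x: "real ((m + k) choose m) = real (Suc k) * real (n choose m) / real n"
        using e1 Suc.prems by (simp add: field_simps)
      have "real n = real m + real (Suc k)" using Suc.prems by simp
      thus ?thesis unfolding e2 x using pos Suc.prems by (simp add: divide_simps)
    qed
    hence "real (Lcm {1..n}) * (1 / (real m * real (n choose m))) =
        real d * (real (Lcm {1..m + k}) / (real m * real ((m + k) choose m)))
         - real (Lcm {1..n}) / (real (m + 1) * real (n choose (m + 1)))"
      by (simp only: d of_nat_mult right_diff_distrib) simp
    also have "\<dots> = of_int (int d * c1 - c2)" unfolding c1 c2 by simp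
    finally show ?case by (metis mult.right_neutral times_divide_eq_right)
  qed
  then obtain c :: int where c: "real (Lcm {1..n}) / (real m * real (n choose m)) = of_int c"
    using assms by (metis le_Suc_ex)
  have pos: "real m * real (n choose m) > 0" using assms by (auto simp: zero_less_binomial)
  have "real_of_int (int (Lcm {1..n})) = of_int (int (m * (n choose m)) * c)"
  proof -
    have "real (Lcm {1..n}) = of_int c * (real m * real (n choose m))"
      using c pos nonzero_divide_eq_eq[of "real m * real (n choose m)"] by (metis less_irrefl)
    thus ?thesis by (simp add: mult_ac)
  qed
  hence "int (Lcm {1..n}) = int (m * (n choose m)) * c" by linarith
  thus ?thesis by (metis dvdI int_dvd_int_iff)
qed

text \<open>The prime power \<open>p ^ multiplicity p (Lcm {1..n})\<close> already divides some
  number up to \<open>n\<close>, so each prime up to \<open>n\<close> contributes a factor of at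
  most \<open>n\<close>.\<close>

lemma Lcm_le_power_card_primes:
  assumes "n \<ge> (1::nat)"
  shows "Lcm {1..n} \<le> n ^ card {p. prime p \<and> p \<le> n}"
proof -
  define P where "P = {p::nat. prime p \<and> p \<le> n}"
  have finP: "finite P" unfolding P_def by simp
  have L0: "Lcm {1..n} \<noteq> 0" by (subst Lcm_0_iff_nat) auto
  have pf: "prime_factors (Lcm {1..n}) \<subseteq> P"
  proof
    fix p assume "p \<in> prime_factors (Lcm {1..n})"
    hence p: "prime p" "p dvd Lcm {1..n}" by auto
    have "Lcm {1..n} dvd \<Prod>{1..n}" by (intro Lcm_least) (auto intro: dvd_prod_eqI)
    hence "p dvd \<Prod>{1..n}" using p dvd_trans by blast
    then obtain k where "k \<in> {1..n}" "p dvd k" using p prime_dvd_prod_iff[of "{1..n}" p id] by auto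
    thus "p \<in> P" using p by (auto simp: P_def dest: dvd_imp_le)
  qed
  have mult: "p ^ multiplicity p (Lcm {1..n}) \<le> n" if "p \<in> P" for p
  proof (rule ccontr)
    assume neg: "\<not> p ^ multiplicity p (Lcm {1..n}) \<le> n"
    define a where "a = multiplicity p (Lcm {1..n})"
    have p: "prime p" using that by (simp add: P_def)
    have a0: "a > 0" using neg assms unfolding a_def by (intro Nat.gr0I) auto
    obtain r where r: "Lcm {1..n} = p ^ a * r" "\<not> p dvd r"
      using multiplicity_decompose'[of "Lcm {1..n}" p] L0 p not_prime_unit[of p] unfolding a_def by blast
    \<comment> \<open>If \<open>p ^ a\<close> exceeds \<open>n\<close>, it divides no
      \<open>k \<le> n\<close>. Dropping one factor \<open>p\<close> then leaves a common multiple,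
      contradicting minimality.\<close>
    have "Lcm {1..n} dvd p ^ (a - 1) * r"
    proof (rule Lcm_least)
      fix k assume k: "k \<in> {1..n}"
      have kL: "k dvd Lcm {1..n}" using k by (rule dvd_Lcm)
      obtain s where s: "k = p ^ multiplicity p k * s" "\<not> p dvd s"
        using multiplicity_decompose'[of k p] k p not_prime_unit[of p] by (metis atLeastAtMost_iff not_one_le_zero)
      have "p ^ multiplicity p k \<le> k" using k by (intro dvd_imp_le multiplicity_dvd) auto
      hence "p ^ multiplicity p k < p ^ a" using k neg unfolding a_def by auto
      hence lt: "multiplicity p k < a" using p prime_gt_1_nat power_less_imp_less_exp by blast
      have "s dvd p ^ a * r" using s kL r by (metis dvd_mult_right)
      moreover have "coprime s (p ^ a)" using s p by (metis coprime_commute coprime_power_right_iff prime_imp_coprime)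
      ultimately have "s dvd r" using coprime_dvd_mult_right_iff by blast
      moreover have "p ^ multiplicity p k dvd p ^ (a - 1)" using lt by (intro le_imp_power_dvd) auto
      ultimately show "k dvd p ^ (a - 1) * r" by (subst s(1)) (rule mult_dvd_mono)
    qed
    hence "p ^ a * r dvd p ^ (a - 1) * r" using r by simp
    moreover have "r > 0" using L0 r by (cases r) auto
    ultimately have "p ^ a dvd p ^ (a - 1)" by simp
    hence "a \<le> a - 1" using p by (metis not_prime_unit power_dvd_imp_le prime_gt_1_nat)
    thus False using a0 by simp
  qed
  have "Lcm {1..n} = (\<Prod>p\<in>prime_factors (Lcm {1..n}). p ^ multiplicity p (Lcm {1..n}))"
    by (rule prime_factorization_nat) (use L0 in \<open>simp only: neq0_conv\<close>)
  also have "\<dots> \<le> (\<Prod>p\<in>prime_factors (Lcm {1..n}). n)" using mult pf by (intro prod_mono) auto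
  also have "\<dots> = n ^ card (prime_factors (Lcm {1..n}))" by simp
  also have "\<dots> \<le> n ^ card P" using pf finP assms by (intro power_increasing card_mono) auto
  finally show ?thesis unfolding P_def .
qed

text \<open>Nair's argument: \<open>n * ((2 * n) choose n)\<close> divides the least common multiple
  of the numbers up to \<open>2 * n\<close>, so \<open>4 ^ n / 2\<close> is at most \<open>x\<close>
  to the power of the number of primes up to \<open>x\<close>.\<close>

lemma chebyshev_lower:
  assumes "x \<ge> (2::real)"
  shows "real (card {p::nat. prime p \<and> real p \<le> x}) \<ge> x / (8 * ln x)"
proof -
  define n where "n = nat \<lfloor>x / 2\<rfloor>"
  define k where "k = card {p::nat. prime p \<and> real p \<le> x}"
  have n1: "n \<ge> 1" using assms by (simp add: n_def le_nat_iff)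
  have nx: "2 * real n \<le> x" "x < 2 * real n + 2" using assms unfolding n_def by linarith+
  have fin: "finite {p::nat. prime p \<and> real p \<le> x}"
    by (rule finite_subset[of _ "{..nat \<lfloor>x\<rfloor>}"]) (auto simp: le_nat_floor)
  have "4 ^ n / real (2 * n) \<le> real ((2 * n) choose n)"
    using central_binomial_lower_bound[of n] n1 by simp
  hence "4 ^ n / 2 \<le> real (n * ((2 * n) choose n))" using n1 by (simp add: field_simps)
  also have "\<dots> \<le> real (Lcm {1..2 * n})"
    using mult_choose_dvd_Lcm[of n "2 * n"] n1
    by (intro of_nat_mono dvd_imp_le) (auto simp: Lcm_0_iff_nat intro!: Nat.gr0I)
  also have "\<dots> \<le> real ((2 * n) ^ card {p. prime p \<and> p \<le> 2 * n})"
    using n1 by (intro of_nat_mono Lcm_le_power_card_primes) auto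
  also have "\<dots> \<le> real (2 * n) ^ k"
    unfolding of_nat_power k_def using nx n1 fin by (intro power_increasing card_mono) auto
  also have "\<dots> \<le> x ^ k" using nx by (intro power_mono) auto
  finally have "ln (4 ^ n / 2) \<le> ln (x ^ k)" using assms by (subst ln_le_cancel_iff) auto
  hence *: "real n * ln 4 - ln 2 \<le> real k * ln x" using assms by (simp add: ln_div ln_realpow)
  have l4: "ln (4::real) = 2 * ln 2" using ln_realpow[of 2 2] by simp
  have "ln (1 / 2 :: real) \<le> 1 / 2 - 1" by (rule ln_le_minus_one) simp
  hence l2: "ln (2::real) \<ge> 1 / 2" by (simp add: ln_div)
  have "(2 * real n - 1) * (1 / 2) \<le> (2 * real n - 1) * ln 2"
    using l2 n1 by (intro mult_left_mono) auto
  hence "(2 * real n - 1) * (1 / 2) \<le> real k * ln x" using * unfolding l4 by (simp add: algebra_simps)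
  \<comment> \<open>As \<open>x < 2 * n + 2\<close>, the left side is below
    \<open>(n + 1) / 4\<close>, which is at most \<open>n - 1 / 2\<close> for
    \<open>n \<ge> 1\<close>.\<close>
  moreover have "x / 8 \<le> (2 * real n - 1) * (1 / 2)" using nx of_nat_mono[OF n1, where ?'a = real] by (simp add: field_simps)
  ultimately have "x / 8 \<le> real k * ln x" by linarith
  thus ?thesis using assms unfolding k_def by (simp add: field_simps)
qed

section \<open>Points of a progression in a coset of roots of unity\<close>

text \<open>For \<open>a\<close> invertible modulo \<open>p\<close>, these are the points of
  \<open>{1..K}\<close> in the coset, represented by the inverse of \<open>a\<close>, of the group
  of \<open>m\<close>-th roots of unity. \<open>K\<close> may exceed \<open>p\<close>, as products
  of several hits require.\<close>

definition hits :: "nat \<Rightarrow> nat \<Rightarrow> nat \<Rightarrow> nat \<Rightarrow> nat set" where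
  "hits p m a K = {j \<in> {1..K}. [(a * j) ^ m = 1] (mod p)}"

lemma finite_hits [simp]: "finite (hits p m a K)"
  by (simp add: hits_def)

text \<open>A hit \<open>n\<close> is determined by \<open>n div p\<close> and the residue of
  \<open>a * n\<close>, which is one of at most \<open>m\<close> roots of unity.\<close>

lemma card_hits_le:
  assumes "prime p" "m > 0" "coprime a p"
  shows "card (hits p m a K) \<le> m * (K div p + 1)"
proof -
  define R where "R = {x \<in> {..<p}. [x ^ m = 1] (mod p)}"
  have p0: "p > 0" using assms(1) prime_gt_0_nat by blast
  have "inj_on (\<lambda>n. ((a * n) mod p, n div p)) (hits p m a K)"
  proof (rule inj_onI)
    fix x y assume "((a * x) mod p, x div p) = ((a * y) mod p, y div p)"
    hence *: "[a * x = a * y] (mod p)" "x div p = y div p" by (auto simp: Cong.cong_def)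
    from *(1) have "[x = y] (mod p)" using assms(3) cong_mult_lcancel_nat by blast
    hence "x mod p = y mod p" by (simp add: Cong.cong_def)
    with *(2) show "x = y" by (metis div_mult_mod_eq)
  qed
  moreover have "(\<lambda>n. ((a * n) mod p, n div p)) ` hits p m a K \<subseteq> R \<times> {..K div p}"
    using p0 by (auto simp: hits_def R_def Cong.cong_def power_mod div_le_mono)
  ultimately have "card (hits p m a K) \<le> card (R \<times> {..K div p})"
    by (intro card_inj_on_le) (auto simp: R_def)
  also have "\<dots> = card R * (K div p + 1)" by (simp add: card_cartesian_product)
  also have "\<dots> \<le> m * (K div p + 1)"
    using roots_mod_prime_bound[of p m 1] assms unfolding R_def by (intro mult_right_mono) auto
  finally show ?thesis .
qed

text \<open>The products of \<open>k\<close> elements stay in one coset of the \<open>m\<close>-th roots of unity, and a product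
  arises from few tuples because all entries divide it.\<close>
lemma card_hits_power_le:
  assumes "prime p" "m > 0" "coprime a p"
    and D: "\<And>n. 1 \<le> n \<Longrightarrow> n \<le> K ^ k \<Longrightarrow> divisor_count n \<le> D"
  shows "card (hits p m a K) ^ k \<le> m * (K ^ k div p + 1) * D ^ k"
proof -
  define A where "A = hits p m a K"
  define B where "B = hits p m (a ^ k) (K ^ k)"
  have prod_pow: "prod_list xs \<in> hits p m (a ^ length xs) (K ^ length xs)" if "set xs \<subseteq> A" for xs
    using that
  proof (induction xs)
    case Nil
    thus ?case by (simp add: hits_def)
  next
    case (Cons x xs)
    hence IH: "prod_list xs \<in> {1..K ^ length xs}" "[(a ^ length xs * prod_list xs) ^ m = 1] (mod p)"
      and x: "x \<in> {1..K}" "[(a * x) ^ m = 1] (mod p)" by (auto simp: hits_def A_def)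
    have "[(a * x) ^ m * (a ^ length xs * prod_list xs) ^ m = 1 * 1] (mod p)"
      using IH(2) x(2) by (rule cong_mult[rotated])
    moreover have "x * prod_list xs \<le> K * K ^ length xs" using IH(1) x(1) by (intro mult_mono) auto
    moreover have "1 \<le> x * prod_list xs" using IH(1) x(1) by (simp add: Suc_le_eq)
    ultimately show ?case by (simp add: hits_def power_mult_distrib mult_ac)
  qed
  define L where "L = {xs. set xs \<subseteq> A \<and> length xs = k}"
  have fin: "finite A" "finite B" by (simp_all add: A_def B_def)
  have "card A ^ k = card L" using card_lists_length_eq[OF fin(1)] by (simp add: L_def)
  also have "\<dots> \<le> card (\<Union>n\<in>B. {xs. set xs \<subseteq> {d. d dvd n} \<and> length xs = k})"
  proof (rule card_mono)
    show "finite (\<Union>n\<in>B. {xs. set xs \<subseteq> {d. d dvd n} \<and> length xs = k})"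
      using fin by (intro finite_UN_I finite_lists_length_eq) (auto simp: B_def hits_def)
    show "L \<subseteq> (\<Union>n\<in>B. {xs. set xs \<subseteq> {d. d dvd n} \<and> length xs = k})"
    proof
      fix xs assume "xs \<in> L"
      hence *: "prod_list xs \<in> B" "length xs = k" using prod_pow[of xs] by (auto simp: L_def B_def)
      have "x dvd prod_list xs" if "x \<in> set xs" for x using that by (auto dest!: split_list)
      thus "xs \<in> (\<Union>n\<in>B. {xs. set xs \<subseteq> {d. d dvd n} \<and> length xs = k})"
        using * by blast
    qed
  qed
  also have "\<dots> \<le> (\<Sum>n\<in>B. card {xs. set xs \<subseteq> {d. d dvd n} \<and> length xs = k})"
    using fin by (intro card_UN_le)
  also have "\<dots> \<le> (\<Sum>n\<in>B. D ^ k)"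
  proof (rule sum_mono)
    fix n assume "n \<in> B"
    hence n: "1 \<le> n" "n \<le> K ^ k" by (auto simp: B_def hits_def)
    have "card {xs. set xs \<subseteq> {d. d dvd n} \<and> length xs = k} = divisor_count n ^ k"
      using n by (subst card_lists_length_eq) (auto simp: divisor_count_def)
    also have "\<dots> \<le> D ^ k" using D[OF n] by (intro power_mono) auto
    finally show "card {xs. set xs \<subseteq> {d. d dvd n} \<and> length xs = k} \<le> D ^ k" .
  qed
  also have "\<dots> = card B * D ^ k" by simp
  also have "\<dots> \<le> m * (K ^ k div p + 1) * D ^ k"
    using card_hits_le[of p m "a ^ k" "K ^ k"] assms unfolding B_def
    by (intro mult_right_mono) auto
  finally show ?thesis unfolding A_def .
qed

section \<open>Solutions of the fixed point congruence\<close>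

definition unity_roots :: "nat \<Rightarrow> nat \<Rightarrow> nat set" where
  "unity_roots p m = {x \<in> {1..p - 1}. [x ^ m = 1] (mod p)}"

lemma finite_unity_roots [simp]: "finite (unity_roots p m)"
  by (simp add: unity_roots_def)

lemma coprime_prime_iff_not_dvd: "prime (p::nat) \<Longrightarrow> coprime a p \<longleftrightarrow> \<not> p dvd a"
  by (metis coprime_absorb_left coprime_commute not_prime_unit prime_imp_coprime)

lemma cong_power_imp_not_dvd:
  assumes "prime (p::nat)" "m > 0" "[x ^ m = 1] (mod p)"
  shows "\<not> p dvd x"
proof
  assume "p dvd x"
  hence "p dvd x ^ m" using assms by (simp add: dvd_power_iff prime_dvd_power_iff)
  hence "p dvd 1" using assms(3) cong_dvd_iff by blast
  thus False using assms(1) by simp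
qed

lemma mod_in_units:
  assumes "prime (p::nat)" "\<not> p dvd x"
  shows "x mod p \<in> {1..p - 1}"
proof -
  have "x mod p < p" using assms prime_gt_0_nat mod_less_divisor by blast
  moreover have "x mod p \<noteq> 0" using assms by (simp add: mod_eq_0_iff_dvd)
  ultimately show ?thesis by auto
qed

lemma primitive_root_obtain:
  assumes "prime p"
  obtains w where "\<not> p dvd w" "ord p w = p - 1" "bij_betw (\<lambda>i. w ^ i mod p) {..<p - 1} {1..p - 1}"
proof -
  have p1: "p > 1" using assms prime_gt_1_nat by blast
  obtain w where w: "residue_primroot p w" using prime_primitive_root_exists[OF _ assms] p1 by auto
  have t: "totatives p = {1..p - 1}" using assms by (simp add: totatives_prime) auto
  have "\<not> p dvd w" using w assms by (auto simp: residue_primroot_def coprime_commute coprime_prime_iff_not_dvd)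
  thus ?thesis using residue_primroot_is_generator[OF p1 w] w assms that[of w]
    by (simp add: t totient_prime residue_primroot_def)
qed

text \<open>The upper bound is the number of roots of a polynomial of degree \<open>m\<close>. For
  the lower bound, the powers of a primitive root with exponents \<open>e * i\<close>,
  \<open>i < m\<close>, are distinct \<open>m\<close>-th roots of unity.\<close>

lemma card_unity_roots:
  assumes "prime p" "m dvd p - 1"
  shows "card (unity_roots p m) = m"
proof (rule antisym)
  have p1: "p > 1" using assms prime_gt_1_nat by blast
  have m0: "m > 0" using assms p1 by (intro Nat.gr0I) auto
  have "card (unity_roots p m) \<le> card {x \<in> {..<p}. [x ^ m = 1] (mod p)}"
    by (intro card_mono) (auto simp: unity_roots_def)
  also have "\<dots> \<le> m" using roots_mod_prime_bound[OF assms(1) m0] .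
  finally show "card (unity_roots p m) \<le> m" .
  obtain w where w: "\<not> p dvd w" "ord p w = p - 1" "bij_betw (\<lambda>i. w ^ i mod p) {..<p - 1} {1..p - 1}"
    using primitive_root_obtain[OF assms(1)] .
  define e where "e = (p - 1) div m"
  have em: "e * m = p - 1" using assms by (simp add: e_def)
  have e0: "e > 0" using em p1 by (intro Nat.gr0I) auto
  have sub: "(\<lambda>i. e * i) ` {..<m} \<subseteq> {..<p - 1}"
  proof
    fix x assume "x \<in> (\<lambda>i. e * i) ` {..<m}"
    then obtain i where "x = e * i" "i < m" by auto
    hence "x < e * m" using e0 by simp
    thus "x \<in> {..<p - 1}" unfolding em by simp
  qed
  have "inj_on (\<lambda>i. w ^ i mod p) ((\<lambda>i. e * i) ` {..<m})"
    using w(3) sub by (meson bij_betw_imp_inj_on inj_on_subset)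
  hence "inj_on ((\<lambda>i. w ^ i mod p) \<circ> (\<lambda>i. e * i)) {..<m}"
    using e0 by (intro comp_inj_on) (auto intro: inj_onI)
  hence "m = card (((\<lambda>i. w ^ i mod p) \<circ> (\<lambda>i. e * i)) ` {..<m})" by (simp only: card_image card_lessThan)
  also have "\<dots> \<le> card (unity_roots p m)"
  proof (intro card_mono)
    show "((\<lambda>i. w ^ i mod p) \<circ> (\<lambda>i. e * i)) ` {..<m} \<subseteq> unity_roots p m"
    proof safe
      fix i assume i: "i < m"
      have "w ^ (e * i) mod p \<in> {1..p - 1}"
        using w(1) assms(1) prime_dvd_power by (intro mod_in_units) blast+
      moreover have "[(w ^ (e * i)) ^ m = 1] (mod p)"
      proof -
        have "e * i * m = (p - 1) * i" unfolding em[symmetric] by (simp only: mult_ac)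
        hence "(w ^ (e * i)) ^ m = w ^ ((p - 1) * i)" by (simp only: power_mult[symmetric])
        thus ?thesis by (simp only: ord_divides w(2) dvd_triv_left)
      qed
      ultimately show "((\<lambda>i. w ^ i mod p) \<circ> (\<lambda>i. e * i)) i \<in> unity_roots p m"
        by (simp add: unity_roots_def Cong.cong_def power_mod)
    qed
  qed simp
  finally show "m \<le> card (unity_roots p m)" .
qed

text \<open>Write \<open>h\<close> as \<open>w ^ t\<close> with a primitive root \<open>w\<close>.
  The condition on \<open>h\<close> forces \<open>e dvd t\<close>, so the linear congruence
  \<open>k * s = t\<close> modulo \<open>p - 1\<close> is solvable, and \<open>w ^ s\<close> is the
  root sought.\<close>

lemma exists_cong_power:
  assumes "prime p" "e dvd p - 1" "\<not> p dvd h" "[h ^ ((p - 1) div e) = 1] (mod p)" "gcd k (p - 1) = e"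
  shows "\<exists>g\<in>{1..p - 1}. [g ^ k = h] (mod p)"
proof -
  have p1: "p > 1" using assms prime_gt_1_nat by blast
  obtain w where w: "\<not> p dvd w" "ord p w = p - 1" "bij_betw (\<lambda>i. w ^ i mod p) {..<p - 1} {1..p - 1}"
    using primitive_root_obtain[OF assms(1)] .
  have "h mod p \<in> {1..p - 1}" by (rule mod_in_units[OF assms(1,3)])
  hence "h mod p \<in> (\<lambda>i. w ^ i mod p) ` {..<p - 1}" using w(3) by (simp only: bij_betw_def)
  then obtain t where t: "w ^ t mod p = h mod p" by fastforce
  define m where "m = (p - 1) div e"
  have me: "m * e = p - 1" using assms by (simp add: m_def)
  have "[w ^ t = h] (mod p)" using t by (simp only: Cong.cong_def)
  hence "[(w ^ t) ^ m = h ^ m] (mod p)" by (rule cong_pow)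
  hence "[w ^ (t * m) = 1] (mod p)" using assms(4) cong_trans unfolding m_def power_mult by blast
  hence "m * e dvd m * t" unfolding ord_divides w(2) me by (simp only: mult.commute)
  moreover have "m \<noteq> 0" using me p1 by (intro notI) simp
  ultimately have "e dvd t" by simp
  then obtain s where s: "[k * s = t] (mod (p - 1))" using cong_solve_dvd_nat assms(5) by blast
  have "[w ^ (k * s) = w ^ t] (mod p)"
    using s order_divides_expdiff[of p w] w(1,2) assms(1)
    by (metis coprime_commute coprime_prime_iff_not_dvd)
  hence "[(w ^ s mod p) ^ k = h] (mod p)" using t by (simp add: Cong.cong_def power_mod mult.commute flip: power_mult)
  moreover have "w ^ s mod p \<in> {1..p - 1}"
  proof -
    have "\<not> p dvd w ^ s" using w(1) assms(1) prime_dvd_power by blast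
    thus ?thesis by (rule mod_in_units[OF assms(1)])
  qed
  ultimately show ?thesis by blast
qed

text \<open>The solutions, if any, form a coset of the \<open>k\<close>-th roots of unity, which by
  Fermat's theorem are the \<open>e\<close>-th roots of unity. A solution \<open>g\<close> makes
  \<open>h ^ ((p - 1) div e)\<close> a power of \<open>g ^ (p - 1)\<close>, hence 1.\<close>

lemma card_power_solutions:
  assumes "prime p" "\<not> p dvd h" and e: "e = gcd k (p - 1)"
  shows "card {g \<in> {1..p - 1}. [g ^ k = h] (mod p)} =
         (if [h ^ ((p - 1) div e) = 1] (mod p) then e else 0)"
proof -
  have p1: "p > 1" using assms prime_gt_1_nat by blast
  have ed: "e dvd p - 1" "e dvd k" using e by auto
  have fermat: "[x ^ (p - 1) = 1] (mod p)" if "\<not> p dvd x" for x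
    using fermat_theorem[OF assms(1) that] .
  have unit: "\<not> p dvd x" if "x \<in> {1..p - 1}" for x
    using that p1 by (auto dest: dvd_imp_le)
  show ?thesis
  proof (cases "[h ^ ((p - 1) div e) = 1] (mod p)")
    case False
    have "\<not> [g ^ k = h] (mod p)" if g: "g \<in> {1..p - 1}" for g
    proof
      assume *: "[g ^ k = h] (mod p)"
      have "[h ^ ((p - 1) div e) = (g ^ k) ^ ((p - 1) div e)] (mod p)"
        using * cong_pow cong_sym by blast
      also have "k * ((p - 1) div e) = (p - 1) * (k div e)"
        using ed by (metis div_mult_swap dvd_mult_div_cancel mult.commute)
      hence "(g ^ k) ^ ((p - 1) div e) = (g ^ (p - 1)) ^ (k div e)" by (simp flip: power_mult)
      also have "[\<dots> = 1 ^ (k div e)] (mod p)" using fermat[OF unit[OF g]] by (rule cong_pow)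
      finally show False using False by simp
    qed
    thus ?thesis using False by (simp add: card_eq_0_iff)
  next
    case True
    obtain g0 where g0: "g0 \<in> {1..p - 1}" "[g0 ^ k = h] (mod p)"
      using exists_cong_power[OF assms(1) ed(1) assms(2) True e[symmetric]] by blast
    have cop: "coprime g0 p" using unit[OF g0(1)] assms(1) coprime_prime_iff_not_dvd by blast
    have root: "[x ^ k = 1] (mod p) \<longleftrightarrow> [x ^ e = 1] (mod p)" if "\<not> p dvd x" for x
    proof -
      have "[x ^ (p - 1) = 1] (mod p)" using fermat that .
      thus ?thesis unfolding ord_divides e by (simp add: gcd_greatest_iff)
    qed
    have "bij_betw (\<lambda>x. g0 * x mod p) (unity_roots p e) {g \<in> {1..p - 1}. [g ^ k = h] (mod p)}"
    proof (rule bij_betw_imageI)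
      show "inj_on (\<lambda>x. g0 * x mod p) (unity_roots p e)"
      proof (rule inj_onI)
        fix x y assume xy: "x \<in> unity_roots p e" "y \<in> unity_roots p e" "g0 * x mod p = g0 * y mod p"
        hence "[x = y] (mod p)" using cong_mult_lcancel_nat[OF cop] by (simp add: Cong.cong_def)
        thus "x = y" using xy p1 by (auto simp: unity_roots_def Cong.cong_def)
      qed
      show "(\<lambda>x. g0 * x mod p) ` unity_roots p e = {g \<in> {1..p - 1}. [g ^ k = h] (mod p)}"
      proof (intro equalityI subsetI)
        fix y assume "y \<in> (\<lambda>x. g0 * x mod p) ` unity_roots p e"
        then obtain x where x: "x \<in> {1..p - 1}" "[x ^ e = 1] (mod p)" "y = g0 * x mod p"
          by (auto simp: unity_roots_def)
        have "\<not> p dvd g0 * x" using unit g0(1) x(1) assms(1) by (simp add: prime_dvd_mult_iff)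
        moreover have "[(g0 * x) ^ k = h * 1] (mod p)"
          unfolding power_mult_distrib using g0(2) root[OF unit[OF x(1)]] x(2) by (intro cong_mult) auto
        ultimately show "y \<in> {g \<in> {1..p - 1}. [g ^ k = h] (mod p)}"
          using mod_in_units[OF assms(1)] x(3) by (auto simp: Cong.cong_def power_mod)
      next
        fix y assume "y \<in> {g \<in> {1..p - 1}. [g ^ k = h] (mod p)}"
        hence y: "y \<in> {1..p - 1}" "[y ^ k = h] (mod p)" by auto
        obtain u where u: "[g0 * u = 1] (mod p)" using cong_solve_coprime_nat[OF cop] by auto
        \<comment> \<open>This is the quotient of the two solutions \<open>y\<close> and
          \<open>g0\<close>, so its \<open>k\<close>-th power is 1.\<close>
        define x where "x = u * y mod p"
        have g0x: "[g0 * x = y] (mod p)"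
        proof -
          have "[g0 * u * y = 1 * y] (mod p)" using u by (rule cong_scalar_right)
          thus ?thesis unfolding x_def by (simp add: Cong.cong_def mod_mult_right_eq mult.assoc)
        qed
        have "\<not> p dvd g0 * x" using g0x unit[OF y(1)] cong_dvd_iff by blast
        hence x: "\<not> p dvd x" using dvd_mult by blast
        have "[h * x ^ k = h * 1] (mod p)"
        proof -
          have "[h * x ^ k = g0 ^ k * x ^ k] (mod p)" using g0(2) by (intro cong_scalar_right) (rule cong_sym)
          also have "[g0 ^ k * x ^ k = y ^ k] (mod p)"
            using cong_pow[OF g0x, of k] by (simp add: power_mult_distrib)
          also have "[y ^ k = h] (mod p)" by (rule y(2))
          finally show ?thesis by simp
        qed
        hence "[x ^ k = 1] (mod p)"
          using coprime_prime_iff_not_dvd[OF assms(1), of h] assms(2) cong_mult_lcancel_nat[of h p "x ^ k" 1] by simp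
        hence "x \<in> unity_roots p e" using root[OF x] mod_in_units[OF assms(1) x]
          by (simp add: unity_roots_def x_def)
        moreover have "y = g0 * x mod p" using g0x y(1) p1 by (auto simp: Cong.cong_def)
        ultimately show "y \<in> (\<lambda>x. g0 * x mod p) ` unity_roots p e" by blast
      qed
    qed
    hence "card {g \<in> {1..p - 1}. [g ^ k = h] (mod p)} = card (unity_roots p e)"
      by (simp add: bij_betw_same_card)
    thus ?thesis using True card_unity_roots[OF assms(1) ed(1)] by simp
  qed
qed

text \<open>Each \<open>h\<close> in \<open>{1..n}\<close> is uniquely \<open>e * j\<close> with
  \<open>e = gcd h n\<close>, \<open>m = n div e\<close> and \<open>j \<le> m\<close> coprime to
  \<open>m\<close>.\<close>

lemma sum_gcd_divisors:
  fixes f :: "nat \<Rightarrow> nat \<Rightarrow> 'b::comm_monoid_add"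
  assumes "n > 0"
  shows "(\<Sum>h\<in>{1..n}. f h (n div gcd h n)) = (\<Sum>m | m dvd n. \<Sum>j | j \<in> {1..m} \<and> coprime j m. f (n div m * j) m)"
proof -
  have "(\<Sum>m | m dvd n. \<Sum>j | j \<in> {1..m} \<and> coprime j m. f (n div m * j) m) =
        (\<Sum>(m, j)\<in>(SIGMA m:{m. m dvd n}. {j. j \<in> {1..m} \<and> coprime j m}). f (n div m * j) m)"
    using assms by (intro sum.Sigma) auto
  also have "\<dots> = (\<Sum>h\<in>{1..n}. f h (n div gcd h n))"
  proof (intro sum.reindex_bij_witness[where i = "\<lambda>h. (n div gcd h n, h div gcd h n)" and j = "\<lambda>x. n div fst x * snd x"])
    fix x assume "x \<in> (SIGMA m:{m. m dvd n}. {j. j \<in> {1..m} \<and> coprime j m})"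
    then obtain m j where x: "x = (m, j)" and m: "m dvd n" and j: "j \<in> {1..m}" "coprime j m" by blast
    obtain e where e: "n = e * m" using m by (metis dvdE mult.commute)
    have pos: "m > 0" "e > 0" using assms e by auto
    have g: "gcd (e * j) (e * m) = e"
    proof -
      have "gcd j m = 1" using j(2) by (simp only: coprime_iff_gcd_eq_1)
      thus ?thesis using gcd_mult_distrib_nat[of e j m] by simp
    qed
    have ne: "n div m = e" using pos e by simp
    have gn: "gcd (e * j) n = e" using g e by simp
    show "(n div gcd (n div fst x * snd x) n, n div fst x * snd x div gcd (n div fst x * snd x) n) = x"
      unfolding x fst_conv snd_conv ne gn using pos e by simp
    show "n div fst x * snd x \<in> {1..n}"
      unfolding x fst_conv snd_conv ne using j pos by (auto simp: e Suc_le_eq)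
    show "f (n div fst x * snd x) (n div gcd (n div fst x * snd x) n) = (case x of (m, j) \<Rightarrow> f (n div m * j) m)"
      unfolding x fst_conv snd_conv ne gn using pos e by simp
  next
    fix h assume h: "h \<in> {1..n}"
    define e where "e = gcd h n"
    have e: "e > 0" "e dvd h" "e dvd n" using assms by (auto simp: e_def)
    obtain h' where h': "h = e * h'" using e by (elim dvdE)
    obtain n' where n': "n = e * n'" using e by (elim dvdE)
    have "e * gcd h' n' = gcd (e * h') (e * n')" by (rule gcd_mult_distrib_nat)
    also have "\<dots> = e" unfolding h'[symmetric] n'[symmetric] by (rule e_def[symmetric])
    finally have "e * gcd h' n' = e * 1" by simp
    hence "gcd h' n' = 1" using e by simp
    hence cop: "coprime h' n'" by (simp only: coprime_iff_gcd_eq_1)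
    have d: "n div gcd h n = n'" "h div gcd h n = h'"
      unfolding e_def[symmetric] using e(1) by (simp_all add: h' n')
    have "h' \<noteq> 0" using h h' by (intro notI) simp
    moreover have "e * h' \<le> e * n'" using h unfolding h'[symmetric] n'[symmetric] by simp
    ultimately have "1 \<le> h'" "h' \<le> n'" using e(1) by simp_all
    thus "(n div gcd h n, h div gcd h n) \<in> (SIGMA m:{m. m dvd n}. {j. j \<in> {1..m} \<and> coprime j m})"
      unfolding d using cop n' by auto
    have "n' > 0" using \<open>1 \<le> h'\<close> \<open>h' \<le> n'\<close> by linarith
    show "n div fst (n div gcd h n, h div gcd h n) * snd (n div gcd h n, h div gcd h n) = h"
    proof -
      have "n div n' = e" using \<open>n' > 0\<close> by (simp add: n')
      thus ?thesis unfolding d fst_conv snd_conv by (simp add: h'[symmetric])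
    qed
  qed
  finally show ?thesis by simp
qed

text \<open>The exponents \<open>h\<close> with \<open>gcd h (p - 1) = (p - 1) div m\<close> that are \<open>gcd h (p - 1)\<close>-th powers
  modulo \<open>p\<close>, encoded by \<open>j = h div gcd h (p - 1)\<close>.\<close>
definition fixed_pts :: "nat \<Rightarrow> nat \<Rightarrow> nat set" where
  "fixed_pts p m = {j \<in> {1..m}. coprime j m \<and> [((p - 1) div m * j) ^ m = 1] (mod p)}"

lemma finite_fixed_pts [simp]: "finite (fixed_pts p m)"
  by (simp add: fixed_pts_def)

text \<open>For each exponent \<open>h\<close> the bases \<open>g\<close> are counted first; a
  contributing \<open>h\<close> with \<open>m = (p - 1) div gcd h (p - 1)\<close> has
  \<open>(p - 1) div m\<close> of them.\<close>

lemma F_eq_sum_divisors: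
  assumes "prime p"
  shows "F p = (\<Sum>m | m dvd p - 1. (p - 1) div m * card (fixed_pts p m))"
proof -
  have p1: "p > 1" using assms prime_gt_1_nat by blast
  have "F p = card (SIGMA h:{1..p - 1}. {g \<in> {1..p - 1}. [g ^ h = h] (mod p)})"
    unfolding F_def
    by (rule bij_betw_same_card[of "\<lambda>(g, h). (h, g)"]) (auto simp: bij_betw_def inj_on_def image_iff)
  also have "\<dots> = (\<Sum>h\<in>{1..p - 1}. card {g \<in> {1..p - 1}. [g ^ h = h] (mod p)})"
    by (rule card_SigmaI) auto
  also have "\<dots> = (\<Sum>h\<in>{1..p - 1}. if [h ^ ((p - 1) div gcd h (p - 1)) = 1] (mod p) then gcd h (p - 1) else 0)"
    using p1 by (intro sum.cong refl card_power_solutions assms) (auto dest: dvd_imp_le)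
  \<comment> \<open>The gcd is rewritten in terms of \<open>(p - 1) div gcd h (p - 1)\<close>, so
    that the summand has the form required by \<open>sum_gcd_divisors\<close>.\<close>
  also have "\<dots> = (\<Sum>h\<in>{1..p - 1}. if [h ^ ((p - 1) div gcd h (p - 1)) = 1] (mod p)
      then (p - 1) div ((p - 1) div gcd h (p - 1)) else 0)"
  proof (intro sum.cong refl)
    fix h
    have "(p - 1) div ((p - 1) div gcd h (p - 1)) = (p - 1) div (p - 1) * gcd h (p - 1)"
      by (rule div_div_eq_right) auto
    hence "(p - 1) div ((p - 1) div gcd h (p - 1)) = gcd h (p - 1)" using p1 by simp
    thus "(if [h ^ ((p - 1) div gcd h (p - 1)) = 1] (mod p) then gcd h (p - 1) else 0) =
      (if [h ^ ((p - 1) div gcd h (p - 1)) = 1] (mod p) then (p - 1) div ((p - 1) div gcd h (p - 1)) else 0)"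
      by (simp only:)
  qed
  also have "\<dots> = (\<Sum>m | m dvd p - 1. \<Sum>j | j \<in> {1..m} \<and> coprime j m.
      if [((p - 1) div m * j) ^ m = 1] (mod p) then (p - 1) div m else 0)"
    using p1 by (intro sum_gcd_divisors) auto
  also have "\<dots> = (\<Sum>m | m dvd p - 1. (p - 1) div m * card (fixed_pts p m))"
  proof (intro sum.cong refl)
    fix m
    have "(\<Sum>j | j \<in> {1..m} \<and> coprime j m. if [((p - 1) div m * j) ^ m = 1] (mod p) then (p - 1) div m else 0)
        = (\<Sum>j\<in>fixed_pts p m. (p - 1) div m)"
      by (intro sum.mono_neutral_cong_right) (auto simp: fixed_pts_def)
    thus "(\<Sum>j | j \<in> {1..m} \<and> coprime j m. if [((p - 1) div m * j) ^ m = 1] (mod p) then (p - 1) div m else 0)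
        = (p - 1) div m * card (fixed_pts p m)" by simp
  qed
  finally show ?thesis .
qed

section \<open>Exponential sums\<close>

text \<open>The standard additive character modulo \<open>p\<close>, on natural numbers. Negative
  frequencies are expressed by \<open>cnj\<close>.\<close>

definition expo :: "nat \<Rightarrow> nat \<Rightarrow> complex" where
  "expo p t = cis (2 * pi * real t / real p)"

lemma norm_expo [simp]: "norm (expo p t) = 1"
  by (simp add: expo_def)

lemma expo_add: "expo p (s + t) = expo p s * expo p t"
  by (simp add: expo_def cis_mult ring_distribs add_divide_distrib)

lemma expo_mult: "expo p (s * t) = expo p s ^ t"

  using DeMoivre[of "2 * pi * real s / real p" t] by (simp add: expo_def mult_ac)

lemma expo_mult_cnj: "expo p s * cnj (expo p s) = 1"
  by (simp add: complex_norm_square[symmetric])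

lemma expo_modulus [simp]: "p > 0 \<Longrightarrow> expo p p = 1"
  by (simp add: expo_def)

lemma expo_mod: "p > 0 \<Longrightarrow> expo p (t mod p) = expo p t"
  by (subst (2) mod_mult_div_eq[of t p, symmetric]) (simp only: expo_add expo_mult expo_modulus power_one mult_1_right)

lemma expo_cong: "p > 0 \<Longrightarrow> [s = t] (mod p) \<Longrightarrow> expo p s = expo p t"
  by (metis Cong.cong_def expo_mod)

lemma expo_eq_1_iff:
  assumes "p > 0"
  shows "expo p t = 1 \<longleftrightarrow> p dvd t"
proof
  assume "p dvd t"
  hence "expo p t = expo p 0" using assms by (intro expo_cong) (auto simp: cong_0_iff)
  thus "expo p t = 1" by (simp add: expo_def)
next
  assume "expo p t = 1"
  hence "cos (2 * pi * real t / real p) = 1" by (auto simp: expo_def complex_eq_iff)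
  then obtain k :: int where "2 * pi * real t / real p = of_int k * 2 * pi"
    by (auto simp: cos_one_2pi_int)
  hence "real t = of_int k * real p" using assms by (simp add: field_simps)
  hence "int t = k * int p" by (metis of_int_eq_iff of_int_mult of_int_of_nat_eq)
  thus "p dvd t" by (metis dvd_triv_right int_dvd_int_iff)
qed

text \<open>This is a geometric sum whose ratio \<open>z\<close> satisfies \<open>z ^ p = 1\<close>,
  with \<open>z = 1\<close> exactly when \<open>u\<close> and \<open>v\<close> are
  congruent.\<close>

lemma sum_expo_orthogonal:
  assumes "p > 0"
  shows "(\<Sum>t<p. expo p (t * u) * cnj (expo p (t * v))) = (if [u = v] (mod p) then of_nat p else 0)"
proof -
  define z where "z = expo p u * cnj (expo p v)"
  have z: "expo p (t * u) * cnj (expo p (t * v)) = z ^ t" for t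
    by (simp add: z_def power_mult_distrib mult.commute[of t] expo_mult)
  have "z ^ p = expo p (p * u) * cnj (expo p (p * v))" by (simp only: z)
  also have "\<dots> = 1" using assms by (simp add: expo_mult)
  finally have zp: "z ^ p = 1" .
  have zeq: "expo p u = z * expo p v"
    using expo_mult_cnj[of p v] by (simp add: z_def mult_ac)
  show ?thesis
  proof (cases "[u = v] (mod p)")
    case True
    hence "z = 1" using expo_cong[OF assms True] by (simp add: z_def expo_mult_cnj)
    thus ?thesis using True by (simp add: z)
  next
    case False
    have "z \<noteq> 1"
    proof
      assume "z = 1"
      hence uv: "expo p u = expo p v" using zeq by simp
      \<comment> \<open>\<open>w\<close> represents \<open>- v\<close> modulo \<open>p\<close>
        within the natural numbers.\<close>
      define w where "w = (p - 1) * v"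
      have "p * v = v + w" using assms by (cases p) (simp_all add: w_def)
      hence vw: "[v + w = 0] (mod p)" by (metis cong_0_iff dvd_triv_left)
      have "expo p (u + w) = expo p (v + w)" by (simp add: expo_add uv)
      also have "\<dots> = 1" using vw by (simp add: expo_eq_1_iff[OF assms] cong_0_iff)
      finally have "[u + w = 0] (mod p)" by (simp add: expo_eq_1_iff[OF assms] cong_0_iff)
      hence "[u + w = v + w] (mod p)" using vw cong_trans cong_sym by blast
      thus False using False by (simp add: cong_add_rcancel_nat)
    qed
    thus ?thesis using False zp by (simp add: z geometric_sum)
  qed
qed

section \<open>Gaussian periods and the Fourier expansion of the number of hits\<close>

definition root_sum :: "nat \<Rightarrow> nat \<Rightarrow> nat \<Rightarrow> complex" where
  "root_sum p m t = (\<Sum>x\<in>unity_roots p m. expo p (t * x))"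

definition interval_sum :: "nat \<Rightarrow> nat \<Rightarrow> nat \<Rightarrow> complex" where
  "interval_sum p K t = (\<Sum>j\<in>{1..K}. expo p (t * j))"

lemma interval_sum_cong: "p > 0 \<Longrightarrow> [s = t] (mod p) \<Longrightarrow> interval_sum p K s = interval_sum p K t"
  unfolding interval_sum_def by (intro sum.cong refl expo_cong cong_scalar_right)

lemma bij_betw_mult_mod:
  fixes a p :: nat
  assumes "prime p" "\<not> p dvd a"
  shows "bij_betw (\<lambda>t. t * a mod p) {1..<p} {1..<p}"
proof (rule bij_betw_imageI)
  have cop: "coprime a p"
    using coprime_prime_iff_not_dvd[OF assms(1), of a] assms(2) by simp
  show inj: "inj_on (\<lambda>t. t * a mod p) {1..<p}"
  proof (rule inj_onI)
    fix x y assume xy: "x \<in> {1..<p}" "y \<in> {1..<p}" "x * a mod p = y * a mod p"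
    hence "[x * a = y * a] (mod p)" by (simp only: Cong.cong_def)
    hence "[x = y] (mod p)" by (simp only: cong_mult_rcancel_nat[OF cop])
    thus "x = y" using xy by (simp add: Cong.cong_def)
  qed
  have "(\<lambda>t. t * a mod p) ` {1..<p} \<subseteq> {1..<p}"
  proof safe
    fix t assume t: "t \<in> {1..<p}"
    hence "\<not> p dvd t" using nat_dvd_not_less[of t p] by simp
    hence "\<not> p dvd t * a" using assms by (simp add: prime_dvd_mult_iff)
    from mod_in_units[OF assms(1) this] show "t * a mod p \<in> {1..<p}" by auto
  qed
  thus "(\<lambda>t. t * a mod p) ` {1..<p} = {1..<p}"
    using inj by (intro card_subset_eq) (auto simp: card_image)
qed

text \<open>Orthogonality detects the congruences \<open>x = a * j\<close> with \<open>x\<close> a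
  root of unity; for each \<open>j\<close> at most one \<open>x\<close> in \<open>{1..p - 1}\<close>
  qualifies, and it does so exactly when \<open>j\<close> is a hit.\<close>

lemma card_hits_conv_sum:
  assumes "prime p" "m > 0"
  shows "of_nat p * of_nat (card (hits p m a K)) =
         (\<Sum>t<p. root_sum p m t * cnj (interval_sum p K (t * a)))"
proof -
  have p1: "p > 1" using assms(1) prime_gt_1_nat by blast
  hence p0: "p > 0" by simp
  define g :: "nat \<Rightarrow> nat \<Rightarrow> nat \<Rightarrow> complex"
    where "g = (\<lambda>t x j. expo p (t * x) * cnj (expo p (t * (a * j))))"
  have "(\<Sum>t<p. root_sum p m t * cnj (interval_sum p K (t * a))) =
        (\<Sum>t<p. \<Sum>x\<in>unity_roots p m. \<Sum>j\<in>{1..K}. g t x j)"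
    by (simp add: root_sum_def interval_sum_def sum_product mult.assoc g_def)
  also have "\<dots> = (\<Sum>x\<in>unity_roots p m. \<Sum>t<p. \<Sum>j\<in>{1..K}. g t x j)" by (rule sum.swap)
  also have "\<dots> = (\<Sum>x\<in>unity_roots p m. \<Sum>j\<in>{1..K}. \<Sum>t<p. g t x j)"
    by (intro sum.cong refl sum.swap)
  also have "\<dots> = (\<Sum>j\<in>{1..K}. \<Sum>x\<in>unity_roots p m. \<Sum>t<p. g t x j)" by (rule sum.swap)
  also have "\<dots> = (\<Sum>j\<in>{1..K}. \<Sum>x\<in>unity_roots p m. if [x = a * j] (mod p) then of_nat p else 0)"
    unfolding g_def by (simp only: sum_expo_orthogonal[OF p0])
  also have "\<dots> = (\<Sum>j\<in>{1..K}. if [(a * j) ^ m = 1] (mod p) then of_nat p else 0)"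
  proof (intro sum.cong refl)
    fix j
    have "(\<Sum>x\<in>unity_roots p m. if [x = a * j] (mod p) then of_nat p else (0::complex)) =
          (\<Sum>x\<in>unity_roots p m \<inter> {a * j mod p}. of_nat p)"
      using p1 by (intro sum.mono_neutral_cong_right) (auto simp: unity_roots_def Cong.cong_def)
    also have "\<dots> = (if a * j mod p \<in> unity_roots p m then of_nat p else 0)" by simp
    also have "a * j mod p \<in> unity_roots p m \<longleftrightarrow> [(a * j) ^ m = 1] (mod p)"
    proof
      assume "a * j mod p \<in> unity_roots p m"
      thus "[(a * j) ^ m = 1] (mod p)" by (simp add: unity_roots_def Cong.cong_def power_mod)
    next
      assume *: "[(a * j) ^ m = 1] (mod p)"
      have "\<not> p dvd a * j" using cong_power_imp_not_dvd[OF assms *] .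
      from mod_in_units[OF assms(1) this] show "a * j mod p \<in> unity_roots p m"
        using * by (simp add: unity_roots_def Cong.cong_def power_mod)
    qed
    finally show "(\<Sum>x\<in>unity_roots p m. if [x = a * j] (mod p) then of_nat p else (0::complex)) =
      (if [(a * j) ^ m = 1] (mod p) then of_nat p else 0)" .
  qed
  also have "\<dots> = (\<Sum>j\<in>hits p m a K. of_nat p)"
    by (intro sum.mono_neutral_cong_right) (auto simp: hits_def)
  finally show ?thesis by (simp add: mult.commute)
qed

text \<open>Parseval's identity: expanding the square leaves only the diagonal pairs,
  \<open>m\<close> in number.\<close>

lemma sum_norm_root_sum:
  assumes "prime p" "m dvd p - 1"
  shows "(\<Sum>t<p. (norm (root_sum p m t))\<^sup>2) = real p * real m"
proof -
  have p1: "p > 1" using assms(1) prime_gt_1_nat by blast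
  hence p0: "p > 0" by simp
  define g :: "nat \<Rightarrow> nat \<Rightarrow> nat \<Rightarrow> complex"
    where "g = (\<lambda>t x y. expo p (t * x) * cnj (expo p (t * y)))"
  have "complex_of_real (\<Sum>t<p. (norm (root_sum p m t))\<^sup>2) =
        (\<Sum>t<p. \<Sum>x\<in>unity_roots p m. \<Sum>y\<in>unity_roots p m. g t x y)"
    unfolding of_real_sum complex_norm_square by (simp add: root_sum_def sum_product g_def)
  also have "\<dots> = (\<Sum>x\<in>unity_roots p m. \<Sum>t<p. \<Sum>y\<in>unity_roots p m. g t x y)" by (rule sum.swap)
  also have "\<dots> = (\<Sum>x\<in>unity_roots p m. \<Sum>y\<in>unity_roots p m. \<Sum>t<p. g t x y)"
    by (intro sum.cong refl sum.swap)
  also have "\<dots> = (\<Sum>x\<in>unity_roots p m. \<Sum>y\<in>unity_roots p m. if [x = y] (mod p) then of_nat p else 0)"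
    unfolding g_def by (simp only: sum_expo_orthogonal[OF p0])
  also have "\<dots> = (\<Sum>x\<in>unity_roots p m. of_nat p)"
  proof (intro sum.cong refl)
    fix x assume x: "x \<in> unity_roots p m"
    have "(\<Sum>y\<in>unity_roots p m. if [x = y] (mod p) then of_nat p else (0::complex)) = (\<Sum>y\<in>{x}. of_nat p)"
      using p1 x by (intro sum.mono_neutral_cong_right) (auto simp: unity_roots_def Cong.cong_def)
    thus "(\<Sum>y\<in>unity_roots p m. if [x = y] (mod p) then of_nat p else (0::complex)) = of_nat p" by simp
  qed
  also have "\<dots> = complex_of_real (real p * real m)"
    using card_unity_roots[OF assms] by (simp add: mult.commute)
  finally show ?thesis by (simp only: of_real_eq_iff)
qed

text \<open>Multiplication by \<open>h\<close> permutes the group of \<open>m\<close>-th roots of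
  unity.\<close>

lemma root_sum_mult_root:
  assumes "prime p" "h \<in> unity_roots p m"
  shows "root_sum p m (t * h) = root_sum p m t"
proof -
  have p1: "p > 1" using assms(1) prime_gt_1_nat by blast
  have h: "h \<in> {1..p - 1}" "[h ^ m = 1] (mod p)" using assms(2) by (auto simp: unity_roots_def)
  have nd: "\<not> p dvd x" if "x \<in> {1..p - 1}" for x using that p1 by (auto dest: dvd_imp_le)
  have sub: "(\<lambda>x. x * h mod p) ` unity_roots p m \<subseteq> unity_roots p m"
  proof safe
    fix x assume "x \<in> unity_roots p m"
    hence x: "x \<in> {1..p - 1}" "[x ^ m = 1] (mod p)" by (auto simp: unity_roots_def)
    have "\<not> p dvd x * h" using nd x h assms(1) by (simp add: prime_dvd_mult_iff)
    moreover have "[x ^ m * h ^ m = 1 * 1] (mod p)" using x h by (intro cong_mult)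
    ultimately show "x * h mod p \<in> unity_roots p m"
      using mod_in_units[OF assms(1)] by (auto simp: unity_roots_def Cong.cong_def power_mod power_mult_distrib)
  qed
  have inj: "inj_on (\<lambda>x. x * h mod p) (unity_roots p m)"
  proof (rule inj_on_subset)
    show "inj_on (\<lambda>x. x * h mod p) {1..<p}"
      using bij_betw_mult_mod[OF assms(1) nd[OF h(1)]] bij_betw_imp_inj_on by blast
  qed (use p1 in \<open>auto simp: unity_roots_def\<close>)
  have bij: "bij_betw (\<lambda>x. x * h mod p) (unity_roots p m) (unity_roots p m)"
    using endo_inj_surj[OF finite_unity_roots sub inj] inj by (simp add: bij_betw_def)
  have "root_sum p m t = (\<Sum>x\<in>unity_roots p m. expo p (t * (x * h mod p)))"
    unfolding root_sum_def by (rule sum.reindex_bij_betw[OF bij, symmetric])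
  also have "\<dots> = root_sum p m (t * h)"
    unfolding root_sum_def using p1
    by (intro sum.cong refl expo_cong) (auto simp: Cong.cong_def mod_mult_right_eq mult_ac)
  finally show ?thesis by simp
qed

text \<open>Root sums are constant on cosets of the group, so each interval sum may be replaced by
  its average over a coset. Cauchy-Schwarz then combines Parseval with the second moment of these
  averages, estimated by their maximum, controlled by \<open>V\<close>, times their total. Any bound
  \<open>V\<close> may be inserted; two choices follow below.\<close>

lemma hits_error:
  assumes "prime p" "m dvd p - 1" "\<not> p dvd a"
    and V: "\<And>u. \<not> p dvd u \<Longrightarrow> (\<Sum>h\<in>unity_roots p m. norm (interval_sum p K (u * h))) \<le> p * V"
  shows "\<bar>real (card (hits p m a K)) - real m * real K / real p\<bar> \<le>
         sqrt (V * (\<Sum>t\<in>{1..<p}. norm (interval_sum p K t)))"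
proof -
  have p1: "p > 1" using assms(1) prime_gt_1_nat by blast
  hence p0: "p > 0" by simp
  have m0: "m > 0" using assms(2) p1 by (intro Nat.gr0I) auto
  define v where "v = (\<lambda>t. norm (interval_sum p K t))"
  define \<eta> where "\<eta> = (\<lambda>t. norm (root_sum p m t))"
  define W where "W = (\<Sum>t\<in>{1..<p}. v t)"
  define E where "E = (\<Sum>t\<in>{1..<p}. \<eta> t * v (t * a))"
  have vcong: "v s = v t" if "[s = t] (mod p)" for s t
    unfolding v_def using interval_sum_cong[OF p0 that] by simp
  have nd: "\<not> p dvd x" if "x \<in> {1..<p}" for x using that nat_dvd_not_less[of x p] by simp
  have ndu: "\<not> p dvd x" if "x \<in> unity_roots p m" for x
    using that p1 by (intro nd) (auto simp: unity_roots_def)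
  have v0: "v t \<ge> 0" for t by (simp add: v_def)
  \<comment> \<open>The frequency 0 contributes \<open>m * K\<close>, which is the main term after
    division by \<open>p\<close>.\<close>
  have split0: "{..<p} = insert 0 {1..<p}" using p0 by auto
  have "complex_of_real (real p * real (card (hits p m a K))) - of_real (real m * real K) =
        (\<Sum>t\<in>{1..<p}. root_sum p m t * cnj (interval_sum p K (t * a)))"
    using card_hits_conv_sum[OF assms(1) m0, of a K] unfolding split0
    by (simp add: root_sum_def interval_sum_def card_unity_roots[OF assms(1,2)] expo_def)
  hence "norm (complex_of_real (real p * real (card (hits p m a K)) - real m * real K)) =
         norm (\<Sum>t\<in>{1..<p}. root_sum p m t * cnj (interval_sum p K (t * a)))" by simp
  also have "\<dots> \<le> (\<Sum>t\<in>{1..<p}. norm (root_sum p m t * cnj (interval_sum p K (t * a))))" by (rule norm_sum)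
  also have "\<dots> = E" unfolding E_def \<eta>_def v_def by (simp add: norm_mult)
  finally have err: "\<bar>real p * real (card (hits p m a K)) - real m * real K\<bar> \<le> E"
    by (simp only: norm_of_real)
  have E0: "E \<ge> 0" using err by linarith
  have reindex: "(\<Sum>t\<in>{1..<p}. f (t * h)) = (\<Sum>t\<in>{1..<p}. f t)"
    if "\<not> p dvd h" and f: "\<And>s t. [s = t] (mod p) \<Longrightarrow> f s = f t" for f :: "nat \<Rightarrow> real" and h
  proof -
    have "(\<Sum>t\<in>{1..<p}. f (t * h)) = (\<Sum>t\<in>{1..<p}. f (t * h mod p))"
      by (intro sum.cong refl f) (simp add: Cong.cong_def)
    also have "\<dots> = (\<Sum>t\<in>{1..<p}. f t)"
      by (rule sum.reindex_bij_betw[OF bij_betw_mult_mod[OF assms(1) that(1)]])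
    finally show ?thesis .
  qed
  have \<eta>cong: "\<eta> s = \<eta> t" if "[s = t] (mod p)" for s t
    unfolding \<eta>_def root_sum_def using that p0
    by (intro arg_cong[where f = norm] sum.cong refl expo_cong cong_scalar_right)
  define U where "U = (\<lambda>u. \<Sum>h\<in>unity_roots p m. v (u * h))"
  have U: "U u \<le> p * V" if "\<not> p dvd u" for u using V[OF that] by (simp add: U_def v_def)
  have U0: "U u \<ge> 0" for u unfolding U_def using v0 by (intro sum_nonneg)
  \<comment> \<open>Substituting \<open>t * h\<close> for \<open>t\<close> leaves
    \<open>\<eta>\<close> unchanged, so \<open>E\<close> has \<open>m\<close> equal expressions, one
    for each \<open>h\<close>; adding them turns \<open>v\<close> into its coset sum
    \<open>U\<close>.\<close>
  have "real m * E = (\<Sum>h\<in>unity_roots p m. E)" by (simp add: card_unity_roots[OF assms(1,2)])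
  also have "\<dots> = (\<Sum>h\<in>unity_roots p m. \<Sum>t\<in>{1..<p}. \<eta> t * v (t * a * h))"
  proof (rule sum.cong[OF refl])
    fix h assume h: "h \<in> unity_roots p m"
    have "E = (\<Sum>t\<in>{1..<p}. \<eta> (t * h) * v (t * h * a))" unfolding E_def
      by (rule reindex[OF ndu[OF h], symmetric]) (metis \<eta>cong vcong cong_scalar_right)
    also have "\<dots> = (\<Sum>t\<in>{1..<p}. \<eta> t * v (t * a * h))"
      using root_sum_mult_root[OF assms(1) h] by (simp add: \<eta>_def mult_ac)
    finally show "E = (\<Sum>t\<in>{1..<p}. \<eta> t * v (t * a * h))" .
  qed
  also have "\<dots> = (\<Sum>t\<in>{1..<p}. \<Sum>h\<in>unity_roots p m. \<eta> t * v (t * a * h))" by (rule sum.swap)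
  also have "\<dots> = (\<Sum>t\<in>{1..<p}. \<eta> t * U (t * a))" by (simp add: U_def sum_distrib_left)
  finally have "(real m * E)\<^sup>2 = (\<Sum>t\<in>{1..<p}. \<eta> t * U (t * a))\<^sup>2" by simp
  also have "\<dots> \<le> (\<Sum>t\<in>{1..<p}. (\<eta> t)\<^sup>2) * (\<Sum>t\<in>{1..<p}. (U (t * a))\<^sup>2)"
    by (rule Cauchy_Schwarz_ineq_sum)
  also have "\<dots> \<le> (real p * real m) * (p * V * (real m * W))"
  proof (rule mult_mono)
    have "(\<Sum>t\<in>{1..<p}. (\<eta> t)\<^sup>2) \<le> (\<Sum>t<p. (\<eta> t)\<^sup>2)" by (intro sum_mono2) auto
    thus "(\<Sum>t\<in>{1..<p}. (\<eta> t)\<^sup>2) \<le> real p * real m"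
      using sum_norm_root_sum[OF assms(1,2)] by (simp add: \<eta>_def)
    \<comment> \<open>One factor \<open>U\<close> is bounded by \<open>p * V\<close>. The other is
      summed over \<open>t\<close>, where every \<open>h\<close> contributes the full sum
      \<open>W\<close>.\<close>
    have "(\<Sum>t\<in>{1..<p}. (U (t * a))\<^sup>2) \<le> (\<Sum>t\<in>{1..<p}. p * V * U (t * a))"
    proof (rule sum_mono)
      fix t assume t: "t \<in> {1..<p}"
      have "\<not> p dvd t * a" using nd[OF t] assms(1,3) by (simp add: prime_dvd_mult_iff)
      thus "(U (t * a))\<^sup>2 \<le> p * V * U (t * a)" using U U0 by (simp add: power2_eq_square mult_right_mono)
    qed
    also have "\<dots> = p * V * (\<Sum>t\<in>{1..<p}. \<Sum>h\<in>unity_roots p m. v (t * a * h))"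
      by (simp add: U_def sum_distrib_left)
    also have "(\<Sum>t\<in>{1..<p}. \<Sum>h\<in>unity_roots p m. v (t * a * h)) =
               (\<Sum>h\<in>unity_roots p m. \<Sum>t\<in>{1..<p}. v (t * (a * h)))"
      by (subst sum.swap) (simp add: mult.assoc)
    also have "\<dots> = (\<Sum>h\<in>unity_roots p m. W)"
    proof (rule sum.cong[OF refl])
      fix h assume h: "h \<in> unity_roots p m"
      have "\<not> p dvd a * h" using ndu[OF h] assms(1,3) by (simp add: prime_dvd_mult_iff)
      from reindex[OF this vcong] show "(\<Sum>t\<in>{1..<p}. v (t * (a * h))) = W" by (simp add: W_def)
    qed
    also have "\<dots> = real m * W" by (simp add: card_unity_roots[OF assms(1,2)])
    finally show "(\<Sum>t\<in>{1..<p}. (U (t * a))\<^sup>2) \<le> p * V * (real m * W)" .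
  qed (auto intro: sum_nonneg)
  finally have "(real m)\<^sup>2 * E\<^sup>2 \<le> (real m)\<^sup>2 * ((real p)\<^sup>2 * (V * W))"
    by (simp add: power2_eq_square mult_ac)
  hence "E\<^sup>2 \<le> (real p)\<^sup>2 * (V * W)" using m0 by simp
  hence "(E / p)\<^sup>2 \<le> V * W" using p0 by (simp add: power_divide divide_le_eq mult.commute)
  hence E_le: "E / p \<le> sqrt (V * W)" by (rule real_le_rsqrt)
  have "\<bar>real (card (hits p m a K)) - real m * real K / real p\<bar> =
        \<bar>real p * real (card (hits p m a K)) - real m * real K\<bar> / p"

  proof -
    have "real (card (hits p m a K)) - real m * real K / real p =
          (real p * real (card (hits p m a K)) - real m * real K) / p"
      using p0 by (simp add: diff_divide_distrib)
    thus ?thesis by simp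
  qed
  also have "\<dots> \<le> E / p" using err by (intro divide_right_mono) auto
  finally show ?thesis using E_le by (simp add: W_def v_def)
qed

section \<open>Bounds for interval sums and the resulting estimates for hits\<close>

lemma sin_ge_third:
  assumes "0 \<le> x" "x \<le> pi / 2"
  shows "sin x \<ge> x / 3"
proof -
  have "\<bar>sin x - (\<Sum>m<3. sin_coeff m * x ^ m)\<bar> \<le> inverse (fact 3) * \<bar>x\<bar> ^ 3"
    by (rule Maclaurin_sin_bound)
  moreover have "(\<Sum>m<3. sin_coeff m * x ^ m) = x" by (simp add: eval_nat_numeral sin_coeff_def)
  ultimately have "\<bar>sin x - x\<bar> \<le> x ^ 3 / 6" using assms by (simp add: fact_numeral)
  hence "sin x \<ge> x - x ^ 3 / 6" using abs_ge_minus_self[of "sin x - x"] by linarith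
  \<comment> \<open>With \<open>x \<le> 2\<close> the cubic term is at most
    \<open>4 * x / 6\<close>, which leaves \<open>x / 3\<close>.\<close>
  moreover have "x * x \<le> 2 * 2" using assms pi_less_4 by (intro mult_mono) auto
  hence "x * (x * x) \<le> x * 4" using assms by (intro mult_left_mono) auto
  ultimately show ?thesis by (simp add: power3_eq_cube)
qed

lemma norm_interval_sum_le: "norm (interval_sum p K t) \<le> real K"
  unfolding interval_sum_def by (rule order_trans[OF norm_sum]) simp

lemma norm_one_minus_expo: "norm (1 - expo p t) = 2 * \<bar>sin (pi * real t / real p)\<bar>"
proof -
  define x where "x = pi * real t / real p"
  have e: "expo p t = cis (2 * x)" by (simp add: expo_def x_def mult_ac)
  have "(norm (1 - expo p t))\<^sup>2 = (1 - cos (2 * x))\<^sup>2 + (sin (2 * x))\<^sup>2"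
    by (simp add: e cmod_def)
  also have "\<dots> = 1 - 2 * cos (2 * x) + ((cos (2 * x))\<^sup>2 + (sin (2 * x))\<^sup>2)"
    by (simp add: power2_eq_square algebra_simps)
  also have "\<dots> = (2 * sin x)\<^sup>2"
    using sin_cos_squared_add2[of "2 * x"] cos_double_sin[of x] by (simp only: power_mult_distrib) simp
  also have "\<dots> = (2 * \<bar>sin x\<bar>)\<^sup>2" by (simp add: power_mult_distrib)
  finally show ?thesis unfolding x_def[symmetric] by (rule power2_eq_imp_eq) auto
qed

text \<open>The geometric sum is at most 2 divided by the distance of its ratio from 1, and this
  distance is at least a constant times the distance of \<open>t / p\<close> to the nearest
  integer.\<close>

lemma norm_interval_sum_le_dist:
  assumes "t \<in> {1..<p}"
  shows "norm (interval_sum p K t) \<le> 2 * real p / real (min t (p - t))"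
proof -
  define n where "n = min t (p - t)"
  have n: "n \<ge> 1" "2 * n \<le> p" using assms by (auto simp: n_def)
  have p0: "real p > 0" using assms by simp
  have S: "interval_sum p K t = expo p t * (\<Sum>j<K. expo p t ^ j)"
  proof -
    have "interval_sum p K t = (\<Sum>j<K. expo p (t * Suc j))"
      unfolding interval_sum_def by (rule sum.reindex_bij_witness[of _ Suc "\<lambda>j. j - 1"]) auto
    thus ?thesis by (simp only: expo_mult power_Suc sum_distrib_left)
  qed
  have "(1 - expo p t) * interval_sum p K t = expo p t * (1 - expo p t ^ K)"
    unfolding S by (simp add: one_diff_power_eq mult_ac)
  hence "norm (1 - expo p t) * norm (interval_sum p K t) = norm (1 - expo p t ^ K)"
    by (metis norm_mult norm_expo mult_1)
  also have "\<dots> \<le> 2" using norm_triangle_ineq4[of 1 "expo p t ^ K"] by (simp add: norm_power)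
  finally have *: "norm (1 - expo p t) * norm (interval_sum p K t) \<le> 2" .
  have "\<bar>sin (pi * real t / real p)\<bar> = \<bar>sin (pi * real n / real p)\<bar>"
  proof (cases "n = t")
    case False
    hence "n = p - t" by (auto simp: n_def min_def)
    hence "pi * real n / real p = pi - pi * real t / real p" using assms p0
      by (simp add: field_simps of_nat_diff)
    thus ?thesis by simp
  qed simp
  also have "\<dots> \<ge> (pi * real n / real p) / 3"
  proof -
    have "pi * real n / real p \<le> pi / 2"
    proof -
      have "pi * (2 * real n) \<le> pi * real p" using n by (intro mult_left_mono) auto
      thus ?thesis using p0 by (simp add: field_simps)
    qed
    from sin_ge_third[OF _ this] show ?thesis by simp
  qed
  finally have "2 * ((pi * real n / real p) / 3) \<le> norm (1 - expo p t)"
    unfolding norm_one_minus_expo by simp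
  moreover have "2 * ((2 * real n / real p) / 3) \<le> 2 * ((pi * real n / real p) / 3)"
    using pi_ge_two p0 by (intro mult_left_mono divide_right_mono mult_right_mono) auto
  ultimately have "2 * ((2 * real n / real p) / 3) * norm (interval_sum p K t) \<le> 2"
    using * by (meson mult_right_mono norm_ge_zero order_trans)
  hence "norm (interval_sum p K t) \<le> (3 / 2) * real p / real n"
    using p0 n by (simp add: field_simps)
  also have "\<dots> \<le> 2 * real p / real n" by (intro divide_right_mono mult_right_mono) auto
  finally show ?thesis by (simp only: n_def)
qed

lemma sum_inverse_Suc_le_ln: "(\<Sum>k\<in>{1..<n}. 1 / real (Suc k)) \<le> ln (real n)" if "n \<ge> 1"
  using that
proof (induction n rule: dec_induct)
  case (step n)
  have "ln (1 - 1 / real (Suc n)) \<le> (1 - 1 / real (Suc n)) - 1"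
    using step by (intro ln_le_minus_one) simp
  also have "1 - 1 / real (Suc n) = real n / real (Suc n)" by (simp add: field_simps)
  also have "real n / real (Suc n) - 1 = - (1 / real (Suc n))" by (simp add: field_simps)
  also have "ln (real n / real (Suc n)) = ln (real n) - ln (real (Suc n))"
    using step(1) by (simp add: ln_div)
  finally show ?case using step by (simp del: of_nat_Suc)
qed simp

text \<open>The reciprocal of the minimum is at most the sum of both reciprocals, which leaves two
  harmonic sums.\<close>

lemma sum_norm_interval_sum_le:
  assumes "p \<ge> 2"
  shows "(\<Sum>t\<in>{1..<p}. norm (interval_sum p K t)) \<le> 4 * real p * (1 + ln (real p))"
proof -
  have "(\<Sum>t\<in>{1..<p}. norm (interval_sum p K t)) \<le> (\<Sum>t\<in>{1..<p}. 2 * real p * (1 / real t + 1 / real (p - t)))"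
  proof (rule sum_mono)
    fix t assume t: "t \<in> {1..<p}"
    have "1 / real (min t (p - t)) \<le> 1 / real t + 1 / real (p - t)" by (auto simp: min_def)
    hence "2 * real p * (1 / real (min t (p - t))) \<le> 2 * real p * (1 / real t + 1 / real (p - t))"
      by (intro mult_left_mono) auto
    thus "norm (interval_sum p K t) \<le> 2 * real p * (1 / real t + 1 / real (p - t))"
      using norm_interval_sum_le_dist[OF t, of K] by simp
  qed
  also have "\<dots> = 2 * real p * ((\<Sum>t\<in>{1..<p}. 1 / real t) + (\<Sum>t\<in>{1..<p}. 1 / real (p - t)))"
    by (simp add: sum_distrib_left[symmetric] sum.distrib)
  also have "(\<Sum>t\<in>{1..<p}. 1 / real (p - t)) = (\<Sum>t\<in>{1..<p}. 1 / real t)"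
    by (rule sum.reindex_bij_witness[of _ "\<lambda>t. p - t" "\<lambda>t. p - t"]) auto
  also have "2 * real p * ((\<Sum>t\<in>{1..<p}. 1 / real t) + (\<Sum>t\<in>{1..<p}. 1 / real t)) \<le>
    2 * real p * ((1 + ln (real p)) + (1 + ln (real p)))"
  proof -
    have "{1..<p} = insert 1 {2..<p}" using assms by auto
    hence "(\<Sum>t\<in>{1..<p}. 1 / real t) = 1 + (\<Sum>t\<in>{2..<p}. 1 / real t)" by simp
    also have "(\<Sum>t\<in>{2..<p}. 1 / real t) = (\<Sum>t\<in>{1..<p - 1}. 1 / real (Suc t))"
      by (rule sum.reindex_bij_witness[of _ Suc "\<lambda>t. t - 1"]) auto
    also have "(\<Sum>t\<in>{1..<p - 1}. 1 / real (Suc t)) \<le> ln (real (p - 1))"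
      using assms by (intro sum_inverse_Suc_le_ln) auto
    also have "\<dots> \<le> ln (real p)" using assms by simp
    finally have "(\<Sum>t\<in>{1..<p}. 1 / real t) \<le> 1 + ln (real p)" by simp
    thus ?thesis by (intro mult_left_mono add_mono) auto
  qed
  finally show ?thesis by (simp add: algebra_simps)
qed

text \<open>First choice of \<open>V\<close>: the frequencies \<open>u * h\<close> are distinct
  nonzero residues, so a coset sum is at most the full sum \<open>W\<close>, and
  \<open>V = W / p\<close> is admissible.\<close>

lemma polya_vinogradov_hits:
  assumes "prime p" "m dvd p - 1" "\<not> p dvd a"
  shows "\<bar>real (card (hits p m a K)) - real m * real K / real p\<bar> \<le> 4 * sqrt (real p) * (1 + ln (real p))"
proof -
  have p1: "p > 1" using assms(1) prime_gt_1_nat by blast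
  define W where "W = (\<Sum>t\<in>{1..<p}. norm (interval_sum p K t))"
  have "\<bar>real (card (hits p m a K)) - real m * real K / real p\<bar> \<le> sqrt (W / p * W)"
    unfolding W_def
  proof (rule hits_error[OF assms])
    fix u assume u: "\<not> p dvd u"
    have inj: "inj_on (\<lambda>h. h * u mod p) (unity_roots p m)"
      by (rule inj_on_subset[OF bij_betw_imp_inj_on[OF bij_betw_mult_mod[OF assms(1) u]]])
         (use p1 in \<open>auto simp: unity_roots_def\<close>)
    have "(\<Sum>h\<in>unity_roots p m. norm (interval_sum p K (u * h))) =
          (\<Sum>h\<in>unity_roots p m. norm (interval_sum p K (h * u mod p)))"
      using p1 by (intro sum.cong refl arg_cong[where f = norm] interval_sum_cong) (auto simp: Cong.cong_def mult.commute)
    also have "\<dots> = (\<Sum>t\<in>(\<lambda>h. h * u mod p) ` unity_roots p m. norm (interval_sum p K t))"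
      using inj by (simp add: sum.reindex)
    also have "\<dots> \<le> W" unfolding W_def
      using bij_betw_mult_mod[OF assms(1) u] p1
      by (intro sum_mono2) (auto simp: bij_betw_def unity_roots_def)
    finally show "(\<Sum>h\<in>unity_roots p m. norm (interval_sum p K (u * h))) \<le>
        real p * ((\<Sum>t\<in>{1..<p}. norm (interval_sum p K t)) / real p)" using p1 by (simp add: W_def)
  qed
  also have "\<dots> = W / sqrt p"
    using p1 by (simp add: real_sqrt_mult real_sqrt_divide W_def sum_nonneg)
  also have "\<dots> \<le> (4 * real p * (1 + ln (real p))) / sqrt p"
    using sum_norm_interval_sum_le[of p K] p1 by (intro divide_right_mono) (auto simp: W_def)
  also have "\<dots> = 4 * sqrt (real p) * (1 + ln (real p))"

  proof -
    have "real p = sqrt (real p) * sqrt (real p)" by simp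
    hence "real p / sqrt (real p) = sqrt (real p)" using p1 by (metis nonzero_mult_div_cancel_right of_nat_0_less_iff real_sqrt_gt_zero less_irrefl p1 less_trans zero_less_one)
    moreover have "4 * real p * (1 + ln (real p)) / sqrt p = 4 * (real p / sqrt p) * (1 + ln (real p))" by simp
    ultimately show ?thesis by (simp only:)
  qed
  finally show ?thesis .
qed

text \<open>Abel summation against the counting function \<open>A \<mapsto> #{h. |u h| \<le> A}\<close>, where \<open>|t|\<close> is the distance
  of \<open>t\<close> to the nearest multiple of \<open>p\<close>.\<close>
lemma inverse_eq_telescoping_sum:
  assumes "1 \<le> k" "k \<le> n"
  shows "1 / real k = (\<Sum>A\<in>{k..<n}. 1 / (real A * real (Suc A))) + 1 / real n"
proof -
  have "(\<Sum>A\<in>{k..<n}. 1 / (real A * real (Suc A))) = (\<Sum>A\<in>{k..<n}. (- 1 / real (Suc A)) - (- 1 / real A))"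
    using assms by (intro sum.cong refl) (simp add: field_simps)
  also have "\<dots> = - 1 / real n - (- 1 / real k)"
    using assms by (intro sum_Suc_diff') auto
  finally show ?thesis by simp
qed

text \<open>If \<open>h * u\<close> is congruent to \<open>r\<close> or \<open>- r\<close> with
  \<open>1 \<le> r \<le> A\<close>, then \<open>r\<close> times the inverse of \<open>u\<close>, or
  its negative, is the root of unity \<open>h\<close>. So \<open>r\<close> is a hit for one of two
  multipliers, and \<open>Q\<close> bounds both counts.\<close>

lemma card_close_roots_le:
  assumes "prime p" "\<not> p dvd u" "A < p" "m > 0"
    and Q: "\<And>b. \<not> p dvd b \<Longrightarrow> real (card (hits p m b A)) \<le> Q"
  shows "real (card {h \<in> unity_roots p m. min (h * u mod p) (p - h * u mod p) \<le> A}) \<le> 2 * Q"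
proof -
  have p1: "p > 1" using assms(1) prime_gt_1_nat by blast
  have cop: "coprime u p" using coprime_prime_iff_not_dvd[OF assms(1), of u] assms(2) by simp
  obtain b where b: "[u * b = 1] (mod p)" using cong_solve_coprime_nat[OF cop] by auto
  \<comment> \<open>\<open>b'\<close> represents \<open>- b\<close> modulo \<open>p\<close>.\<close>
  define b' where "b' = (p - 1) * b"
  have bnd: "\<not> p dvd b"
  proof
    assume "p dvd b"
    hence "p dvd u * b" by simp
    hence "p dvd 1" using b Cong.cong_dvd_iff by blast
    thus False using p1 by simp
  qed
  have "\<not> p dvd p - 1" using nat_dvd_not_less[of "p - 1" p] p1 by simp
  hence b'nd: "\<not> p dvd b'" unfolding b'_def using bnd assms(1) by (simp add: prime_dvd_mult_iff)
  define S where "S = {h \<in> unity_roots p m. min (h * u mod p) (p - h * u mod p) \<le> A}"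
  define S1 where "S1 = {h \<in> unity_roots p m. h * u mod p \<le> A}"
  define S2 where "S2 = {h \<in> unity_roots p m. p - h * u mod p \<le> A}"
  have h_props: "h \<in> {1..<p}" "[h ^ m = 1] (mod p)" "\<not> p dvd h" if "h \<in> unity_roots p m" for h
  proof -
    show "h \<in> {1..<p}" "[h ^ m = 1] (mod p)" using that p1 by (auto simp: unity_roots_def)
    thus "\<not> p dvd h" using nat_dvd_not_less[of h p] by simp
  qed
  have inj: "inj_on (\<lambda>h. h * u mod p) (unity_roots p m)"
    by (rule inj_on_subset[OF bij_betw_imp_inj_on[OF bij_betw_mult_mod[OF assms(1,2)]]])
       (use h_props in auto)
  have "card S1 \<le> card (hits p m b A)"
  proof (rule card_inj_on_le)
    show "inj_on (\<lambda>h. h * u mod p) S1" by (rule inj_on_subset[OF inj]) (auto simp: S1_def)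
    show "(\<lambda>h. h * u mod p) ` S1 \<subseteq> hits p m b A"
    proof safe
      fix h assume h: "h \<in> S1"
      hence hr: "h \<in> unity_roots p m" "h * u mod p \<le> A" by (auto simp: S1_def)
      have "\<not> p dvd h * u" using h_props(3)[OF hr(1)] assms(1,2) by (simp add: prime_dvd_mult_iff)
      hence "h * u mod p \<in> {1..A}" using mod_in_units[OF assms(1)] hr(2) by auto
      moreover have "[b * (h * u mod p) = h * (u * b)] (mod p)"
        by (simp add: Cong.cong_def mod_mult_right_eq mult_ac)
      hence "[b * (h * u mod p) = h * 1] (mod p)" using b cong_trans cong_scalar_left by blast
      hence "[(b * (h * u mod p)) ^ m = (h * 1) ^ m] (mod p)" by (rule cong_pow)
      hence "[(b * (h * u mod p)) ^ m = 1] (mod p)" using h_props(2)[OF hr(1)] cong_trans by simp blast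
      ultimately show "h * u mod p \<in> hits p m b A" by (simp add: hits_def)
    qed
  qed simp
  moreover have "card S2 \<le> card (hits p m b' A)"
  proof (rule card_inj_on_le)
    show "inj_on (\<lambda>h. p - h * u mod p) S2"
    proof (rule inj_onI)
      fix x y assume xy: "x \<in> S2" "y \<in> S2" "p - x * u mod p = p - y * u mod p"
      have "x * u mod p < p" "y * u mod p < p" using p1 by auto
      hence "x * u mod p = y * u mod p" using xy(3) by linarith
      thus "x = y" using inj_onD[OF inj, of x y] xy(1,2) by (simp add: S2_def)
    qed
    show "(\<lambda>h. p - h * u mod p) ` S2 \<subseteq> hits p m b' A"
    proof safe
      fix h assume h: "h \<in> S2"
      hence hr: "h \<in> unity_roots p m" "p - h * u mod p \<le> A" by (auto simp: S2_def)
      define r where "r = h * u mod p"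
      have rp: "r < p" using p1 by (simp add: r_def)
      hence "p - r \<in> {1..A}" using hr(2) by (auto simp: r_def)
      moreover have "[b' * (p - r) = h] (mod p)"
      proof -
        obtain q where q: "p = r + Suc q" using less_imp_Suc_add[OF rp] by auto
        have "(p - 1) * (p - r) = (r + q) * Suc q" by (subst (1 2) q) simp
        also have "\<dots> = r + (r + Suc q) * q" by (simp add: algebra_simps)
        also have "\<dots> = r + p * q" by (simp only: q[symmetric])
        finally have "b' * (p - r) = b * r + p * (b * q)"
          unfolding b'_def by (metis (no_types, lifting) distrib_left mult.assoc mult.left_commute mult.commute)
        hence "[b' * (p - r) = b * r] (mod p)" by (simp add: Cong.cong_def)
        also have "[b * r = h * (u * b)] (mod p)"
          by (simp add: r_def Cong.cong_def mod_mult_right_eq mult_ac)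
        also have "[h * (u * b) = h * 1] (mod p)" using b by (rule cong_scalar_left)
        finally show ?thesis by simp
      qed
      hence "[(b' * (p - r)) ^ m = h ^ m] (mod p)" by (rule cong_pow)
      hence "[(b' * (p - r)) ^ m = 1] (mod p)" using h_props(2)[OF hr(1)] cong_trans by blast
      ultimately show "p - h * u mod p \<in> hits p m b' A" by (simp add: hits_def r_def)
    qed
  qed simp
  moreover have "card S \<le> card S1 + card S2"
  proof -
    have "card S \<le> card (S1 \<union> S2)" by (intro card_mono) (auto simp: S_def S1_def S2_def)
    thus ?thesis using card_Un_le[of S1 S2] by linarith
  qed
  ultimately have "real (card S) \<le> real (card (hits p m b A)) + real (card (hits p m b' A))" by linarith
  thus ?thesis using Q[OF bnd] Q[OF b'nd] unfolding S_def by linarith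
qed

text \<open>Second choice of \<open>V\<close>: a frequency at distance \<open>d\<close> from the
  multiples of \<open>p\<close> contributes at most \<open>2 * p / max T d\<close>, for
  \<open>d < T\<close> by the trivial bound and \<open>T * K \<le> p\<close>. The hypothesis on
  \<open>Q\<close> says that few frequencies of a coset are small, so \<open>V\<close> shrinks with
  \<open>Q\<close> and \<open>m / p\<close>.\<close>

lemma refined_hits_error:
  assumes "prime p" "m dvd p - 1" "\<not> p dvd a" "1 \<le> T" "T < p" "T * K \<le> p" "Q \<ge> 0"
    and Q: "\<And>b A. \<not> p dvd b \<Longrightarrow> T \<le> A \<Longrightarrow> A < p \<Longrightarrow> real (card (hits p m b A)) \<le> Q * real A"
  shows "\<bar>real (card (hits p m a K)) - real m * real K / real p\<bar> \<le>
    sqrt (2 * (2 * Q * ln (real p) + real m / real p) * (4 * real p * (1 + ln (real p))))"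
proof -
  have p1: "p > 1" using assms(1) prime_gt_1_nat by blast
  have m0: "m > 0" using assms(2) p1 by (intro Nat.gr0I) auto
  define V where "V = 2 * (2 * Q * ln (real p) + real m / real p)"
  have V0: "V \<ge> 0" using assms(7) p1 by (simp add: V_def)
  have "\<bar>real (card (hits p m a K)) - real m * real K / real p\<bar> \<le>
        sqrt (V * (\<Sum>t\<in>{1..<p}. norm (interval_sum p K t)))"
  proof (rule hits_error[OF assms(1-3)])
    fix u assume u: "\<not> p dvd u"
    define d where "d = (\<lambda>h. min (h * u mod p) (p - h * u mod p))"
    have hu: "h * u mod p \<in> {1..<p}" if "h \<in> unity_roots p m" for h
    proof -
      have "h \<in> {1..<p}" using that p1 by (auto simp: unity_roots_def)
      hence "\<not> p dvd h" using nat_dvd_not_less[of h p] by simp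
      hence "\<not> p dvd h * u" using u assms(1) by (simp add: prime_dvd_mult_iff)
      from mod_in_units[OF assms(1) this] show ?thesis by auto
    qed
    have d: "1 \<le> d h" "d h < p" if "h \<in> unity_roots p m" for h using hu[OF that] by (auto simp: d_def)
    have "norm (interval_sum p K (u * h)) \<le> 2 * real p * ((\<Sum>A\<in>{T..<p}. if d h \<le> A then 1 / (real A * real (Suc A)) else 0) + 1 / real p)"
      if h: "h \<in> unity_roots p m" for h
    proof -
      have "interval_sum p K (u * h) = interval_sum p K (h * u mod p)"
        using p1 by (intro interval_sum_cong) (auto simp: Cong.cong_def mult.commute)
      moreover have "norm (interval_sum p K (h * u mod p)) \<le> 2 * real p / real (max T (d h))"
      proof (cases "T \<le> d h")
        case True
        thus ?thesis using norm_interval_sum_le_dist[OF hu[OF h], of K] by (simp add: d_def max_def)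
      next
        case False
        have "real T * real K \<le> real p" using assms(6) by (metis of_nat_le_iff of_nat_mult)
        hence "real K \<le> 2 * real p / real T" using assms(4) by (simp add: field_simps)
        thus ?thesis using norm_interval_sum_le[of p K "h * u mod p"] False by (simp add: max_def)
      qed
      ultimately have "norm (interval_sum p K (u * h)) \<le> 2 * real p * (1 / real (max T (d h)))" by simp
      also have "1 / real (max T (d h)) = (\<Sum>A\<in>{max T (d h)..<p}. 1 / (real A * real (Suc A))) + 1 / real p"
        using assms(4,5) d[OF h] by (intro inverse_eq_telescoping_sum) auto
      \<comment> \<open>Passing to a range of \<open>A\<close> independent of \<open>h\<close>
        allows the sums to be exchanged; the inner sum then counts the roots with
        \<open>d h \<le> A\<close>.\<close>
      also have "(\<Sum>A\<in>{max T (d h)..<p}. 1 / (real A * real (Suc A))) =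
                 (\<Sum>A\<in>{T..<p}. if d h \<le> A then 1 / (real A * real (Suc A)) else 0)"
        by (intro sum.mono_neutral_cong_left) auto
      finally show ?thesis .
    qed
    hence "(\<Sum>h\<in>unity_roots p m. norm (interval_sum p K (u * h))) \<le>
      (\<Sum>h\<in>unity_roots p m. 2 * real p * ((\<Sum>A\<in>{T..<p}. if d h \<le> A then 1 / (real A * real (Suc A)) else 0) + 1 / real p))"
      by (rule sum_mono)
    also have "\<dots> = 2 * real p * ((\<Sum>h\<in>unity_roots p m. \<Sum>A\<in>{T..<p}. if d h \<le> A then 1 / (real A * real (Suc A)) else 0) + real m / real p)"
      using card_unity_roots[OF assms(1,2)] by (simp add: sum_distrib_left[symmetric] sum.distrib)
    also have "(\<Sum>h\<in>unity_roots p m. \<Sum>A\<in>{T..<p}. if d h \<le> A then 1 / (real A * real (Suc A)) else 0) =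
       (\<Sum>A\<in>{T..<p}. \<Sum>h\<in>unity_roots p m. if d h \<le> A then 1 / (real A * real (Suc A)) else 0)"
      by (rule sum.swap)
    also have "2 * real p * ((\<Sum>A\<in>{T..<p}. \<Sum>h\<in>unity_roots p m. if d h \<le> A then 1 / (real A * real (Suc A)) else 0) + real m / real p)
       \<le> 2 * real p * (2 * Q * ln (real p) + real m / real p)"
    proof -
      have "(\<Sum>A\<in>{T..<p}. \<Sum>h\<in>unity_roots p m. if d h \<le> A then 1 / (real A * real (Suc A)) else 0) \<le>
            (\<Sum>A\<in>{T..<p}. 2 * Q * (1 / real (Suc A)))"
      proof (rule sum_mono)
        fix A assume A: "A \<in> {T..<p}"
        have "(\<Sum>h\<in>unity_roots p m. if d h \<le> A then 1 / (real A * real (Suc A)) else 0) =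
              (\<Sum>h\<in>{h \<in> unity_roots p m. d h \<le> A}. 1 / (real A * real (Suc A)))"
          by (intro sum.mono_neutral_cong_right) auto
        also have "\<dots> = real (card {h \<in> unity_roots p m. d h \<le> A}) / (real A * real (Suc A))" by simp
        also have "\<dots> \<le> 2 * (Q * real A) / (real A * real (Suc A))"
          unfolding d_def using A Q by (intro divide_right_mono card_close_roots_le[OF assms(1) u _ m0]) auto
        also have "\<dots> = 2 * Q * (1 / real (Suc A))" using A assms(4) by simp
        finally show "(\<Sum>h\<in>unity_roots p m. if d h \<le> A then 1 / (real A * real (Suc A)) else 0) \<le> 2 * Q * (1 / real (Suc A))" .
      qed
      also have "\<dots> \<le> (\<Sum>A\<in>{1..<p}. 2 * Q * (1 / real (Suc A)))"
        using assms(4,7) by (intro sum_mono2) auto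
      also have "\<dots> = 2 * Q * (\<Sum>A\<in>{1..<p}. 1 / real (Suc A))" by (simp add: sum_distrib_left)
      also have "\<dots> \<le> 2 * Q * ln (real p)"
        using sum_inverse_Suc_le_ln[of p] p1 assms(7) by (intro mult_left_mono) auto
      finally show ?thesis by (intro mult_left_mono add_right_mono) auto
    qed
    also have "\<dots> = real p * V" by (simp add: V_def)
    finally show "(\<Sum>h\<in>unity_roots p m. norm (interval_sum p K (u * h))) \<le> real p * V" .
  qed
  also have "\<dots> \<le> sqrt (V * (4 * real p * (1 + ln (real p))))"
    using sum_norm_interval_sum_le[of p K] p1 V0 by (intro real_sqrt_le_mono mult_left_mono) auto
  finally show ?thesis by (simp only: V_def)
qed

section \<open>Sieving by the primes dividing \<open>m\<close>\<close>

text \<open>Distinct sets of prime divisors of \<open>m\<close> have distinct products, all dividing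
  \<open>m\<close>.\<close>

lemma two_power_card_prime_factors_le:
  assumes "m > 0"
  shows "2 ^ card (prime_factors m) \<le> divisor_count m"
proof -
  have dvd: "\<Prod>S dvd m" if "S \<subseteq> prime_factors m" for S
  proof -
    have "finite S" using that finite_subset by blast
    thus ?thesis using that
    proof (induction S rule: finite_induct)
      case (insert q S)
      have "coprime q (\<Prod>S)"
      proof (rule prod_coprime_right)
        fix r assume "r \<in> S"
        thus "coprime q r" using insert.hyps insert.prems by (intro primes_coprime) auto
      qed
      thus ?case using insert by (auto intro: divides_mult)
    qed simp
  qed
  have "inj_on \<Prod> (Pow (prime_factors m))"
  proof (rule inj_onI)
    have sub: "S \<subseteq> S'" if "S \<subseteq> prime_factors m" "S' \<subseteq> prime_factors m" "\<Prod>S = \<Prod>S'" for S S'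
    proof
      fix q assume q: "q \<in> S"
      have fin: "finite S" "finite S'" using that finite_subset by blast+
      have "q dvd \<Prod>S" using q fin by (intro dvd_prodI[where f = "\<lambda>x. x", simplified]) auto
      hence "q dvd \<Prod>S'" using that(3) by simp
      moreover have "prime q" using q that(1) by auto
      ultimately obtain r where "r \<in> S'" "q dvd r" using prime_dvd_prod_iff[OF fin(2), of q "\<lambda>x. x"] by auto
      moreover have "prime r" using \<open>r \<in> S'\<close> that(2) by auto
      ultimately show "q \<in> S'" using \<open>prime q\<close> primes_dvd_imp_eq by blast
    qed
    fix S S' assume "S \<in> Pow (prime_factors m)" "S' \<in> Pow (prime_factors m)" "\<Prod>S = \<Prod>S'"
    thus "S = S'" using sub[of S S'] sub[of S' S] by auto
  qed
  moreover have "\<Prod> ` Pow (prime_factors m) \<subseteq> {k. k dvd m}" using dvd by auto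
  ultimately have "card (Pow (prime_factors m)) \<le> card {k. k dvd m}"
    using assms by (intro card_inj_on_le) auto
  thus ?thesis by (simp add: card_Pow divisor_count_def)
qed

text \<open>Inclusion-exclusion over the prime divisors of \<open>m\<close>, one prime at a time.\<close>
lemma sieved_hits_error:
  assumes "prime p" "m dvd p - 1" "finite Q" "\<And>q. q \<in> Q \<Longrightarrow> prime q \<and> q dvd m \<and> coprime D q" "D dvd m"
  shows "\<bar>real (card {j \<in> {1..m}. D dvd j \<and> (\<forall>q\<in>Q. \<not> q dvd j) \<and> [((p - 1) div m * j) ^ m = 1] (mod p)}) -
     real m * real m / real D / real p * (\<Prod>q\<in>Q. 1 - 1 / real q)\<bar> \<le>
     2 ^ card Q * (4 * sqrt (real p) * (1 + ln (real p)))"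
  using assms(3-5)
proof (induction Q arbitrary: D rule: finite_induct)
  case empty
  have p1: "p > 1" using assms(1) prime_gt_1_nat by blast
  have m0: "m > 0" using assms(2) p1 by (intro Nat.gr0I) auto
  define e where "e = (p - 1) div m"
  have em: "e * m = p - 1" using assms(2) by (simp add: e_def)
  obtain K where K: "m = D * K" using empty by (elim dvdE)
  have D0: "D > 0" using K m0 by (intro Nat.gr0I) auto
  have eD0: "e * D > 0" using D0 em p1 by (intro Nat.gr0I) auto
  have "e * D \<le> e * m" using dvd_imp_le[OF empty(2) m0] by (rule mult_le_mono2)
  hence "e * D < p" using em p1 by linarith
  hence nd: "\<not> p dvd e * D" using eD0 nat_dvd_not_less by blast
  have "bij_betw (\<lambda>j. D * j) (hits p m (e * D) K) {j \<in> {1..m}. D dvd j \<and> [(e * j) ^ m = 1] (mod p)}"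
  proof (rule bij_betw_imageI)
    show "inj_on (\<lambda>j. D * j) (hits p m (e * D) K)" using D0 by (intro inj_onI) simp
    show "(\<lambda>j. D * j) ` hits p m (e * D) K = {j \<in> {1..m}. D dvd j \<and> [(e * j) ^ m = 1] (mod p)}"
    proof (intro equalityI subsetI)
      fix x assume "x \<in> (\<lambda>j. D * j) ` hits p m (e * D) K"
      then obtain j where j: "x = D * j" "1 \<le> j" "j \<le> K" "[(e * D * j) ^ m = 1] (mod p)"
        by (auto simp: hits_def)
      have "1 \<le> D * j" "D * j \<le> D * K" using j(2,3) D0 by (auto simp: Suc_le_eq)
      thus "x \<in> {j \<in> {1..m}. D dvd j \<and> [(e * j) ^ m = 1] (mod p)}"
        using j by (auto simp: K mult.assoc)
    next
      fix x assume "x \<in> {j \<in> {1..m}. D dvd j \<and> [(e * j) ^ m = 1] (mod p)}"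
      hence x: "x \<in> {1..m}" "D dvd x" "[(e * x) ^ m = 1] (mod p)" by auto
      from x(2) obtain j where j: "x = D * j" by (elim dvdE)
      have "1 \<le> j" using x(1) j by (cases j) auto
      moreover have "j \<le> K" using x(1) j D0 K by simp
      ultimately have "j \<in> hits p m (e * D) K" using x(3) j by (simp add: hits_def mult.assoc)
      thus "x \<in> (\<lambda>j. D * j) ` hits p m (e * D) K" using j by blast
    qed
  qed
  hence "card {j \<in> {1..m}. D dvd j \<and> [(e * j) ^ m = 1] (mod p)} = card (hits p m (e * D) K)"
    by (simp add: bij_betw_same_card)
  moreover have "real m * real m / real D / real p = real m * real K / real p"
    using K D0 by simp
  ultimately show ?case using polya_vinogradov_hits[OF assms(1,2) nd, of K] by (simp add: e_def)
next
  case (insert q Q)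
  define S where "S = (\<lambda>Q D. {j \<in> {1..m}. D dvd j \<and> (\<forall>q\<in>Q. \<not> q dvd j) \<and> [((p - 1) div m * j) ^ m = 1] (mod p)})"
  define M where "M = (\<lambda>D::nat. real m * real m / real D / real p * (\<Prod>q\<in>Q. 1 - 1 / real q))"
  have q: "prime q" "q dvd m" "coprime D q" using insert.prems(1) by auto
  have dq: "D * q dvd j \<longleftrightarrow> D dvd j \<and> q dvd j" for j
    using q(3) by (metis divides_mult dvd_mult_left dvd_mult_right)
  \<comment> \<open>Excluding multiples of \<open>q\<close> subtracts the count for
    \<open>D * q\<close> from that for \<open>D\<close>. The main terms differ by the factor
    \<open>1 - 1 / q\<close>, and the error bound doubles.\<close>
  have "S (insert q Q) D = S Q D - S Q (D * q)" "S Q (D * q) \<subseteq> S Q D"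
    using dq by (auto simp: S_def)
  moreover have "finite (S Q D)" by (simp add: S_def)
  ultimately have "real (card (S (insert q Q) D)) = real (card (S Q D)) - real (card (S Q (D * q)))"
    by (simp add: card_Diff_subset finite_subset card_mono of_nat_diff)
  moreover have "\<bar>real (card (S Q D)) - M D\<bar> \<le> 2 ^ card Q * (4 * sqrt (real p) * (1 + ln (real p)))"
    unfolding S_def M_def using insert.prems by (intro insert.IH) auto
  moreover have "\<bar>real (card (S Q (D * q))) - M (D * q)\<bar> \<le> 2 ^ card Q * (4 * sqrt (real p) * (1 + ln (real p)))"
    unfolding S_def M_def
  proof (rule insert.IH)
    fix r assume r: "r \<in> Q"
    have "coprime q r" using r insert.hyps insert.prems(1) by (intro primes_coprime) auto
    thus "prime r \<and> r dvd m \<and> coprime (D * q) r" using r insert.prems(1) by auto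
  next
    show "D * q dvd m" using dq q insert.prems(2) by blast
  qed
  moreover have "real m * real m / real D / real p * (\<Prod>q\<in>insert q Q. 1 - 1 / real q) = M D - M (D * q)"

  proof -
    have "M (D * q) = M D * (1 / real q)" by (simp add: M_def)
    moreover have "real m * real m / real D / real p * (\<Prod>q\<in>insert q Q. 1 - 1 / real q) = M D * (1 - 1 / real q)"
      using insert.hyps by (simp add: M_def)
    ultimately show ?thesis by (simp only: right_diff_distrib mult_1_right)
  qed
  ultimately have "\<bar>real (card (S (insert q Q) D)) - real m * real m / real D / real p * (\<Prod>q\<in>insert q Q. 1 - 1 / real q)\<bar>
     \<le> 2 * (2 ^ card Q * (4 * sqrt (real p) * (1 + ln (real p))))"
    by linarith
  thus ?case using insert.hyps by (simp add: S_def mult.assoc)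
qed

text \<open>Euler's product turns the sieved main term into \<open>m * totient m / p\<close>.
  Multiplied by \<open>(p - 1) div m\<close> this is \<open>totient m\<close> up to
  \<open>totient m / p\<close>, which the summand 1 absorbs.\<close>

lemma fixed_pts_polya_vinogradov:
  assumes "prime p" "m dvd p - 1"
  shows "\<bar>real ((p - 1) div m * card (fixed_pts p m)) - real (totient m)\<bar> \<le>
    1 + real ((p - 1) div m) * (real (divisor_count m) * (4 * sqrt (real p) * (1 + ln (real p))))"
proof -
  have p1: "p > 1" using assms(1) prime_gt_1_nat by blast
  have m0: "m > 0" using assms(2) p1 by (intro Nat.gr0I) auto
  define e where "e = (p - 1) div m"
  define E where "E = 4 * sqrt (real p) * (1 + ln (real p))"
  have E0: "E \<ge> 0" using p1 by (simp add: E_def)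
  have em: "e * m = p - 1" using assms(2) by (simp add: e_def)
  have "fixed_pts p m = {j \<in> {1..m}. 1 dvd j \<and> (\<forall>q\<in>prime_factors m. \<not> q dvd j) \<and> [((p - 1) div m * j) ^ m = 1] (mod p)}"
  proof -
    have "coprime j m \<longleftrightarrow> (\<forall>q\<in>prime_factors m. \<not> q dvd j)" if "j \<in> {1..m}" for j
    proof
      assume "coprime j m"
      thus "\<forall>q\<in>prime_factors m. \<not> q dvd j"
        using coprime_common_divisor not_prime_unit by (metis in_prime_factors_iff)
    next
      assume *: "\<forall>q\<in>prime_factors m. \<not> q dvd j"
      show "coprime j m"
      proof (rule ccontr)
        assume "\<not> coprime j m"
        hence "gcd j m \<noteq> 1" using coprime_iff_gcd_eq_1 by blast
        then obtain q where "prime q" "q dvd gcd j m" using prime_factor_nat by blast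
        thus False using * m0 by (auto simp: in_prime_factors_iff)
      qed
    qed
    thus ?thesis by (auto simp: fixed_pts_def)
  qed
  hence "\<bar>real (card (fixed_pts p m)) - real m * real m / real 1 / real p * (\<Prod>q\<in>prime_factors m. 1 - 1 / real q)\<bar>
     \<le> 2 ^ card (prime_factors m) * E"
    unfolding E_def by (simp only:) (intro sieved_hits_error assms, auto)
  also have "\<dots> \<le> real (divisor_count m) * E"
    using of_nat_mono[OF two_power_card_prime_factors_le[OF m0], where ?'a = real] E0 by (intro mult_right_mono) auto
  also have "real m * real m / real 1 / real p * (\<Prod>q\<in>prime_factors m. 1 - 1 / real q) =
             real m * real (totient m) / real p"
    using totient_formula2[of m] by simp
  finally have *: "\<bar>real (card (fixed_pts p m)) - real m * real (totient m) / real p\<bar> \<le> real (divisor_count m) * E" .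
  have "real e * \<bar>real (card (fixed_pts p m)) - real m * real (totient m) / real p\<bar> \<le>
        real e * (real (divisor_count m) * E)"
    using * by (intro mult_left_mono) auto
  moreover have "real e * \<bar>real (card (fixed_pts p m)) - real m * real (totient m) / real p\<bar> =
     \<bar>real e * (real (card (fixed_pts p m)) - real m * real (totient m) / real p)\<bar>" by (simp add: abs_mult)
  moreover have "real e * (real (card (fixed_pts p m)) - real m * real (totient m) / real p) =
     real (e * card (fixed_pts p m)) - real (p - 1) * real (totient m) / real p"

  proof -
    have "real e * real m = real (p - 1)" by (simp only: em of_nat_mult[symmetric])
    moreover have "real e * (real (card (fixed_pts p m)) - real m * real (totient m) / real p) =
      real (e * card (fixed_pts p m)) - (real e * real m) * real (totient m) / real p"
      by (simp add: right_diff_distrib mult.assoc)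
    ultimately show ?thesis by (simp only:)
  qed
  moreover have "real (p - 1) * real (totient m) / real p = real (totient m) - real (totient m) / real p"
    using p1 by (simp add: field_simps of_nat_diff)
  moreover have "real (totient m) / real p \<le> 1"
  proof -
    have "m \<le> p - 1" using assms(2) p1 by (intro dvd_imp_le) auto
    hence "totient m \<le> p" using totient_le[of m] by linarith
    thus ?thesis using p1 by simp
  qed
  moreover have "real (totient m) / real p \<ge> 0" by simp
  moreover have "\<bar>x - t\<bar> \<le> 1 + z" if "u \<le> z" "u = \<bar>w\<bar>" "w = x - y" "y = t - s" "s \<le> 1" "0 \<le> s"
    for u z w x y t s :: real using that by linarith
  ultimately show ?thesis unfolding e_def[symmetric] E_def[symmetric] by blast
qed

section \<open>Estimates for all ranges of \<open>m\<close>\<close>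

text \<open>For \<open>A \<le> p\<close> and \<open>k \<le> 3\<close> all products are at most
  \<open>p ^ 3\<close>, so their divisor counts are at most
  \<open>C * p powr (3 * \<epsilon>)\<close>.\<close>

lemma hits_power_bound:
  assumes "prime p" "m > 0" "\<not> p dvd b" "A \<le> p" "k \<le> 3" "C \<ge> 1" "\<epsilon> > 0"
    and C: "\<And>n. n > 0 \<Longrightarrow> real (divisor_count n) \<le> C * real n powr \<epsilon>"
  shows "real (card (hits p m b A)) ^ k \<le> real m * (real A ^ k / real p + 1) * (C * real p powr (3 * \<epsilon>)) ^ k"
proof -
  have p0: "p > 0" using assms(1) prime_gt_0_nat by blast
  define D where "D = nat \<lfloor>C * real p powr (3 * \<epsilon>)\<rfloor>"
  have cop: "coprime b p" using coprime_prime_iff_not_dvd[OF assms(1), of b] assms(3) by simp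
  have "card (hits p m b A) ^ k \<le> m * (A ^ k div p + 1) * D ^ k"
  proof (rule card_hits_power_le[OF assms(1,2) cop])
    fix n assume n: "1 \<le> n" "n \<le> A ^ k"
    have "A ^ k \<le> p ^ k" using assms(4) by (rule power_mono) simp
    also have "p ^ k \<le> p ^ 3" using p0 assms(5) by (intro power_increasing) auto
    finally have "real n \<le> real (p ^ 3)" using n(2) by linarith
    hence "real n powr \<epsilon> \<le> real (p ^ 3) powr \<epsilon>" using assms(7) by (intro powr_mono2) auto
    also have "real (p ^ 3) powr \<epsilon> = real p powr (3 * \<epsilon>)"
    proof -
      have "real (p ^ 3) = real p powr 3" using p0 by (simp add: powr_numeral)
      thus ?thesis by (simp only: powr_powr)
    qed
    finally have "C * real n powr \<epsilon> \<le> C * real p powr (3 * \<epsilon>)" using assms(6) by (intro mult_left_mono) auto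
    hence "real (divisor_count n) \<le> C * real p powr (3 * \<epsilon>)" using C[of n] n(1) by simp
    thus "divisor_count n \<le> D" unfolding D_def by (rule le_nat_floor)
  qed
  hence "real (card (hits p m b A) ^ k) \<le> real (m * (A ^ k div p + 1) * D ^ k)" by (rule of_nat_mono)
  also have "\<dots> = real m * (real (A ^ k div p) + 1) * real D ^ k"
    by (simp only: of_nat_mult of_nat_add of_nat_power of_nat_1)
  also have "\<dots> \<le> real m * (real A ^ k / real p + 1) * (C * real p powr (3 * \<epsilon>)) ^ k"
  proof (intro mult_mono power_mono add_right_mono)
    show "real (A ^ k div p) \<le> real A ^ k / real p" using of_nat_div_le_of_nat[of "A ^ k" p] by simp
    show "real D \<le> C * real p powr (3 * \<epsilon>)" unfolding D_def using assms(6)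
      by (intro of_nat_floor) auto
  qed (use assms(6) in auto)
  finally show ?thesis by simp
qed

lemma card_fixed_pts_le_hits: "card (fixed_pts p m) \<le> card (hits p m ((p - 1) div m) m)"
  by (intro card_mono) (auto simp: fixed_pts_def hits_def)

text \<open>With \<open>m = p powr \<mu>\<close>: triple products for \<open>0.3 \<le> \<mu> \<le> 0.4\<close>, double products for \<open>0.4 \<le> \<mu> \<le> 0.65\<close>,
  the refined exponential sum bound for \<open>0.65 \<le> \<mu> \<le> 0.7\<close> and the sieve for larger \<open>\<mu>\<close>.\<close>
lemma fixed_pts_error:
  assumes p: "prime p" "m dvd p - 1" and "C \<ge> 1" "\<epsilon> > 0"
    and C: "\<And>n. n > 0 \<Longrightarrow> real (divisor_count n) \<le> C * real n powr \<epsilon>"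
    and small: "real m \<le> real p powr 0.3 \<Longrightarrow> fixed_pts p m = {}"
  shows "\<bar>real ((p - 1) div m * card (fixed_pts p m)) - real (totient m)\<bar> \<le>
    10 * (1 + ln (real p)) * real p powr 0.825 * (C * real p powr (3 * \<epsilon>))"
proof -
  define e where "e = (p - 1) div m"
  define P M E where "P = real p" and "M = real m" and "E = real e"
  define B where "B = C * P powr (3 * \<epsilon>)"
  define N where "N = real (card (fixed_pts p m))"
  define L where "L = 1 + ln P"
  have p1: "p > 1" using assms(1) prime_gt_1_nat by blast
  have m0: "m > 0" using assms(2) p1 by (intro Nat.gr0I) auto
  have em: "e * m = p - 1" using assms(2) by (simp add: e_def)
  have e0: "e > 0" using em p1 by (intro Nat.gr0I) auto
  have "e * 1 \<le> e * m" using m0 by (intro mult_le_mono2) auto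
  hence ep: "e < p" using em p1 by linarith
  hence e_nd: "\<not> p dvd e" using e0 nat_dvd_not_less by blast
  have "real e * real m = real p - 1" using em p1 by (metis of_nat_mult of_nat_1 of_nat_diff less_imp_le)
  hence EM: "E * M \<le> P" "E * M \<ge> P / 2" using p1 by (simp_all add: E_def M_def P_def)
  have pos: "P > 1" "M \<ge> 1" "E \<ge> 1" "N \<ge> 0" using p1 m0 e0 by (simp_all add: P_def M_def E_def N_def)
  have B1: "B \<ge> 1"
  proof -
    have "1 * 1 \<le> C * P powr (3 * \<epsilon>)" using assms(3,4) pos(1) by (intro mult_mono ge_one_powr_ge_zero) auto
    thus ?thesis by (simp add: B_def)
  qed
  have L1: "L \<ge> 1" using pos(1) by (simp add: L_def)
  have powr_le: "P powr a \<le> P powr b" if "a \<le> b" for a b using that pos(1) by (intro powr_mono) auto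
  have powr_ge1: "P powr a \<ge> 1" if "a \<ge> 0" for a using powr_le[OF that] pos(1) by simp
  have pk: "(P powr a) ^ k = P powr (a * real k)" for a k
  proof -
    have "P powr a > 0" using pos(1) by simp
    from powr_realpow[OF this, of k] show ?thesis by (simp only: powr_powr)
  qed
  have P_pow: "P ^ 2 = P powr 2" "P ^ 3 = P powr 3" "P = P powr 1" using pos(1) by (simp_all add: powr_numeral)
  \<comment> \<open>The exponent 0.825 is dictated by the double products at
    \<open>M = P powr 0.65\<close>, where \<open>(E * N) ^ 2\<close> is bounded by about
    \<open>P powr 1.65\<close>.\<close>
  define R where "R = L * P powr 0.825 * B"
  have R_ge: "x * y * z \<le> R" if "x \<le> L" "y \<le> P powr 0.825" "z \<le> B" "0 \<le> y" "0 \<le> z" for x y z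
    unfolding R_def using that L1 B1 by (intro mult_mono) auto
  have R_powr: "P powr a * B \<le> R" if "a \<le> 0.825" for a
    using R_ge[of 1 "P powr a" B] L1 B1 powr_le[OF that] by simp
  have R_powr1: "P powr a \<le> R" if "a \<le> 0.825" for a
    using R_ge[of 1 "P powr a" 1] L1 B1 powr_le[OF that] by simp
  have R7: "P powr 0.7 \<le> R" and R0: "1 \<le> R" and R8: "P powr 0.8 * B \<le> R" and R825: "P powr 0.825 * B \<le> R"
    using R_powr1[of "0.7"] R_powr1[of 0] R_powr[of "0.8"] R_powr[of "0.825"] pos(1) by simp_all
  have mono7: "P powr 0.3 \<le> P powr 0.7" "P powr 0.4 \<le> P powr 0.7" "P powr 0.65 \<le> P powr 0.7"
      "P powr 1.6 \<le> P powr 1.65" "P powr 0.9 \<le> P powr 1"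
    by (rule powr_le; simp)+
  have tot: "real (totient m) \<le> M" using totient_le[of m] by (simp add: M_def)
  have NM: "N \<le> real (card (hits p m e m))" using card_fixed_pts_le_hits[of p m] by (simp add: N_def e_def)
  have mp: "m \<le> p" using em e0 by (metis One_nat_def Suc_leI diff_le_self le_trans mult_le_mono1 mult_1)
  have hits: "N ^ k \<le> M * (M ^ k / P + 1) * B ^ k" if "k \<le> 3" for k
  proof -
    have "N ^ k \<le> real (card (hits p m e m)) ^ k" using NM pos(4) by (rule power_mono)
    also have "\<dots> \<le> M * (M ^ k / P + 1) * B ^ k"
      unfolding M_def P_def B_def by (rule hits_power_bound[OF p(1) m0 e_nd mp that assms(3,4) C])
    finally show ?thesis .
  qed
  \<comment> \<open>Up to \<open>P powr 0.7\<close> the totient itself is within the admissible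
    error, so an upper bound for \<open>E * N\<close> is enough.\<close>
  have combine: "\<bar>E * N - real (totient m)\<bar> \<le> 10 * R" if "E * N \<le> 9 * R" "M \<le> P powr 0.7"
  proof -
    have "real (totient m) \<le> R" using that(2) tot R7 by linarith
    moreover have "E * N \<ge> 0" using pos by simp
    moreover have "R \<ge> 0" using R0 by simp
    ultimately show ?thesis using that(1) by linarith
  qed
  consider "M \<le> P powr 0.3" | "P powr 0.3 < M" "M \<le> P powr 0.4" | "P powr 0.4 < M" "M \<le> P powr 0.65"
    | "P powr 0.65 < M" "M \<le> P powr 0.7" | "P powr 0.7 < M" by linarith
  hence "\<bar>E * N - real (totient m)\<bar> \<le> 10 * R"
  proof cases
    case 1
    hence "N = 0" using small by (simp add: N_def M_def P_def)
    moreover have "M \<le> P powr 0.7" using 1 mono7(1) by linarith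
    moreover have "R \<ge> 0" using R0 by simp
    ultimately show ?thesis by (intro combine) auto
  next
    case 2
    have "(E * N) ^ 3 \<le> E ^ 3 * (M * (M ^ 3 / P + 1) * B ^ 3)"
      unfolding power_mult_distrib using hits[of 3] pos by (intro mult_left_mono) auto
    \<comment> \<open>As \<open>E * M \<le> P\<close>, the first term is largest at
      \<open>M = P powr 0.4\<close> and the second at \<open>M = P powr 0.3\<close>; both extremes
      are \<open>P powr 2.4\<close>.\<close>
    also have "\<dots> = ((E * M) ^ 3 * (M / P) + (E * M) ^ 3 / M ^ 2) * B ^ 3"
      using pos by (simp add: field_simps eval_nat_numeral)
    also have "\<dots> \<le> (P ^ 3 * (P powr 0.4 / P) + P ^ 3 / (P powr 0.3) ^ 2) * B ^ 3"
      using 2 EM pos B1 by (intro mult_right_mono add_mono mult_mono divide_right_mono frac_le power_mono) auto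
    also have "P ^ 3 * (P powr 0.4 / P) = P powr 2.4"
    proof -
      have "P ^ 3 * (P powr 0.4 / P) = P powr 3 * P powr 0.4 / P powr 1" unfolding pk P_pow(1,2) using P_pow(3) by simp
      also have "\<dots> = P powr 2.4" unfolding powr_add[symmetric] powr_diff[symmetric] by simp
      finally show ?thesis .
    qed
    also have "P ^ 3 / (P powr 0.3) ^ 2 = P powr 2.4"
    proof -
      have "P ^ 3 / (P powr 0.3) ^ 2 = P powr 3 / P powr 0.6" unfolding pk P_pow(1,2) using P_pow(3) by simp
      also have "\<dots> = P powr 2.4" unfolding powr_add[symmetric] powr_diff[symmetric] by simp
      finally show ?thesis .
    qed
    also have "(P powr 2.4 + P powr 2.4) * B ^ 3 \<le> 8 * P powr 2.4 * B ^ 3"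
      using B1 by (intro mult_right_mono) auto
    also have "8 * P powr 2.4 * B ^ 3 = (2 * (P powr 0.8 * B)) ^ 3"
      by (simp add: power_mult_distrib pk)
    finally have "E * N \<le> 2 * (P powr 0.8 * B)"
      using B1 pos by (subst (asm) power_mono_iff) auto
    hence "E * N \<le> 9 * R" using R8 R0 by linarith
    thus ?thesis using 2 mono7 by (intro combine) linarith+
  next
    case 3
    have "(E * N) ^ 2 \<le> E ^ 2 * (M * (M ^ 2 / P + 1) * B ^ 2)"
      unfolding power_mult_distrib using hits[of 2] pos by (intro mult_left_mono) auto
    \<comment> \<open>The first term is largest at the upper end of the range, with value
      \<open>P powr 1.65\<close>, the second at the lower end, with value
      \<open>P powr 1.6\<close>.\<close>
    also have "\<dots> = ((E * M) ^ 2 * (M / P) + (E * M) ^ 2 / M) * B ^ 2"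
      using pos by (simp add: field_simps eval_nat_numeral)
    also have "\<dots> \<le> (P ^ 2 * (P powr 0.65 / P) + P ^ 2 / P powr 0.4) * B ^ 2"
      using 3 EM pos B1 by (intro mult_right_mono add_mono mult_mono divide_right_mono frac_le power_mono) auto
    also have "P ^ 2 * (P powr 0.65 / P) = P powr 1.65"
    proof -
      have "P ^ 2 * (P powr 0.65 / P) = P powr 2 * P powr 0.65 / P powr 1" unfolding pk P_pow(1,2) using P_pow(3) by simp
      also have "\<dots> = P powr 1.65" unfolding powr_add[symmetric] powr_diff[symmetric] by simp
      finally show ?thesis .
    qed
    also have "P ^ 2 / P powr 0.4 = P powr 1.6"
    proof -
      have "P ^ 2 / P powr 0.4 = P powr 2 / P powr 0.4" unfolding pk P_pow(1,2) using P_pow(3) by simp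
      also have "\<dots> = P powr 1.6" unfolding powr_add[symmetric] powr_diff[symmetric] by simp
      finally show ?thesis .
    qed
    also have "(P powr 1.65 + P powr 1.6) * B ^ 2 \<le> 4 * P powr 1.65 * B ^ 2"
    proof (rule mult_right_mono)
      show "P powr 1.65 + P powr 1.6 \<le> 4 * P powr 1.65" using mono7(4) powr_ge_zero[of P "1.65"] by linarith
    qed (use B1 in simp)
    also have "4 * P powr 1.65 * B ^ 2 = (2 * (P powr 0.825 * B)) ^ 2"
      by (simp add: power_mult_distrib pk)
    finally have "E * N \<le> 2 * (P powr 0.825 * B)"
      using B1 pos by (subst (asm) power_mono_iff) auto
    hence "E * N \<le> 9 * R" using R825 R0 by linarith
    thus ?thesis using 3 mono7 by (intro combine) linarith+
  next
    case 4
    \<comment> \<open>For \<open>A \<ge> e\<close> the bound \<open>E \<ge> P powr 0.3 / 2\<close>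
      makes 1 at most \<open>8 * A ^ 3 / P powr 0.9\<close>. Triple products thus bound the cube of
      the count by \<open>9 * P powr (0.7 - 0.9) * A ^ 3 * B ^ 3\<close>; a third of -0.2 is -1/15,
      and 9 is rounded up to \<open>3 ^ 3\<close>.\<close>
    define Q where "Q = 3 * (P powr (-1/15) * B)"
    have E_ge: "E \<ge> P powr 0.3 / 2"
    proof -
      have "P / 2 \<le> E * P powr 0.7" using EM(2) mult_left_mono[OF 4(2), of E] pos by linarith
      hence "P / P powr 0.7 / 2 \<le> E" using pos by (simp add: field_simps)
      also have "P / P powr 0.7 = P powr 0.3" using pos powr_diff[of P 1 "0.7"] by simp
      finally show ?thesis .
    qed
    have E_le: "E \<le> P powr 0.35"
    proof -
      have "E * P powr 0.65 \<le> P" using EM(1) mult_left_mono[OF less_imp_le[OF 4(1)], of E] pos by linarith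
      hence "E \<le> P / P powr 0.65" using pos by (simp add: field_simps)
      also have "P / P powr 0.65 = P powr 0.35" using pos powr_diff[of P 1 "0.65"] by simp
      finally show ?thesis .
    qed
    have Qb: "real (card (hits p m b A)) \<le> Q * real A" if "\<not> p dvd b" "e \<le> A" "A < p" for b A
    proof -
      have A: "E \<le> real A" using that by (simp add: E_def)
      have "real (card (hits p m b A)) ^ 3 \<le> M * (real A ^ 3 / P + 1) * B ^ 3"
        unfolding M_def P_def B_def using that by (intro hits_power_bound[OF p(1) m0 _ _ _ assms(3,4) C]) auto
      also have "\<dots> \<le> P powr 0.7 * (real A ^ 3 / P powr 0.9 + 8 * real A ^ 3 / P powr 0.9) * B ^ 3"
      proof (intro mult_right_mono mult_mono add_mono divide_left_mono)
        show "P powr 0.9 \<le> P" using mono7(5) pos by simp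
        have "(P powr 0.3 / 2) ^ 3 \<le> real A ^ 3" using E_ge A by (intro power_mono) auto
        hence "P powr 0.9 / 8 \<le> real A ^ 3" by (simp add: power_divide pk)
        thus "1 \<le> 8 * real A ^ 3 / P powr 0.9" using pos by (simp add: field_simps)
      qed (use 4 pos B1 in auto)
      also have "\<dots> = 9 * (P powr 0.7 / P powr 0.9) * real A ^ 3 * B ^ 3"
        using pos by (simp add: field_simps)
      also have "P powr 0.7 / P powr 0.9 = P powr (-1/5)" using powr_diff[of P "0.7" "0.9"] by simp
      also have "9 * P powr (-1/5) * real A ^ 3 * B ^ 3 \<le> 27 * P powr (-1/5) * real A ^ 3 * B ^ 3"
        using B1 by (intro mult_right_mono) auto
      also have "\<dots> = (Q * real A) ^ 3"
        by (simp add: Q_def power_mult_distrib pk)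
      finally show ?thesis using B1 pos by (subst (asm) power_mono_iff) (auto simp: Q_def)
    qed
    have Q0: "Q \<ge> 0" using B1 by (simp add: Q_def)
    have "e * m \<le> p" using em by simp
    hence "\<bar>real (card (hits p m e m)) - M * M / P\<bar> \<le>
      sqrt (2 * (2 * Q * ln P + M / P) * (4 * P * (1 + ln P)))"
      unfolding M_def P_def using e0 ep Q0 Qb by (intro refined_hits_error[OF p e_nd, where T = e]) auto
    also have "\<dots> \<le> sqrt ((8 * L * (P powr (7/15) * B)) ^ 2)"
    proof (rule real_sqrt_le_mono)
      have "M / P \<le> P powr 0.7 / P" using 4 pos by (intro divide_right_mono) auto
      also have "\<dots> = P powr (-0.3)" using pos powr_diff[of P "0.7" 1] by simp
      also have "\<dots> \<le> P powr (-1/15)" by (intro powr_le) simp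
      finally have MP: "M / P \<le> P powr (-1/15)" .
      have "P powr (-1/15) * 1 \<le> P powr (-1/15) * (3 * B)" using B1 by (intro mult_left_mono) auto
      hence "P powr (-1/15) \<le> 3 * (P powr (-1/15) * B)" by (simp add: mult_ac)
      with MP have MQ: "M / P \<le> Q" unfolding Q_def by linarith
      have "2 * (2 * Q * ln P + M / P) * (4 * P * (1 + ln P)) \<le> 2 * (2 * Q * L) * (4 * P * L)"
        using MQ pos Q0 L1 by (intro mult_mono) (auto simp: L_def algebra_simps)
      also have "\<dots> = 48 * L\<^sup>2 * (P * P powr (-1/15)) * B" by (simp add: Q_def power2_eq_square)
      also have "P * P powr (-1/15) = P powr (14/15)" using pos powr_add[of P 1 "-1/15"] by simp
      also have "48 * L\<^sup>2 * P powr (14/15) * B \<le> 64 * L\<^sup>2 * P powr (14/15) * B\<^sup>2"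
        using B1 L1 by (intro mult_mono) (auto simp: power2_eq_square)
      also have "\<dots> = (8 * L * (P powr (7/15) * B)) ^ 2"
        by (simp add: power_mult_distrib pk)
      finally show "2 * (2 * Q * ln P + M / P) * (4 * P * (1 + ln P)) \<le> (8 * L * (P powr (7/15) * B)) ^ 2" .
    qed
    also have "\<dots> = 8 * L * (P powr (7/15) * B)" using L1 B1 by simp
    finally have "N \<le> M * M / P + 8 * L * (P powr (7/15) * B)" using NM by linarith
    hence "E * N \<le> E * (M * M / P + 8 * L * (P powr (7/15) * B))" using pos by (intro mult_left_mono) auto
    also have "\<dots> = (E * M / P) * M + E * (8 * L * (P powr (7/15) * B))" by (simp add: algebra_simps)
    also have "\<dots> \<le> 1 * P powr 0.7 + P powr 0.35 * (8 * L * (P powr (7/15) * B))"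
      using EM 4 E_le pos L1 B1 by (intro add_mono mult_mono) auto
    \<comment> \<open>Half of \<open>14/15\<close> is \<open>7/15\<close>, and
      \<open>0.35 + 7/15 = 49/60\<close> lies just below 0.825.\<close>
    also have "P powr 0.35 * (8 * L * (P powr (7/15) * B)) = 8 * (L * P powr (49/60) * B)"
      using powr_add[of P "0.35" "7/15"] by simp
    also have "8 * (L * P powr (49/60) * B) \<le> 8 * R" using B1 by (intro mult_left_mono R_ge powr_le) auto
    finally have "E * N \<le> 9 * R" using R7 by simp
    thus ?thesis using 4 by (intro combine) auto
  next
    case 5
    have E_le: "E \<le> P powr 0.3"
    proof -
      have "E * P powr 0.7 \<le> P" using EM(1) mult_left_mono[OF less_imp_le[OF 5], of E] pos by linarith
      hence "E \<le> P / P powr 0.7" using pos by (simp add: field_simps)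
      also have "P / P powr 0.7 = P powr 0.3" using pos powr_diff[of P 1 "0.7"] by simp
      finally show ?thesis .
    qed
    have d: "real (divisor_count m) \<le> B"
    proof -
      have "real (divisor_count m) \<le> C * real m powr \<epsilon>" by (rule C[OF m0])
      also have "\<dots> \<le> C * P powr \<epsilon>" using mp assms(3,4) by (intro mult_left_mono powr_mono2) (auto simp: P_def)
      also have "\<dots> \<le> B" unfolding B_def using assms(3,4) by (intro mult_left_mono powr_le) auto
      finally show ?thesis .
    qed
    have "\<bar>E * N - real (totient m)\<bar> \<le> 1 + E * (real (divisor_count m) * (4 * sqrt P * L))"
      using fixed_pts_polya_vinogradov[OF p] by (simp add: E_def N_def e_def P_def L_def)
    also have "\<dots> \<le> 1 + P powr 0.3 * (B * (4 * sqrt P * L))"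
      using E_le d pos L1 B1 by (intro add_left_mono mult_mono) auto
    also have "P powr 0.3 * (B * (4 * sqrt P * L)) = 4 * (L * P powr 0.8 * B)"
      using powr_add[of P "0.3" "1/2"] pos by (simp add: powr_half_sqrt)
    also have "4 * (L * P powr 0.8 * B) \<le> 4 * R" using B1 by (intro mult_left_mono R_ge powr_le) auto
    finally show ?thesis using R0 by simp
  qed
  thus ?thesis
    unfolding R_def E_def N_def L_def B_def P_def e_def by (simp only: mult.assoc of_nat_mult)
qed

section \<open>Exceptional primes\<close>

text \<open>Since \<open>(p - 1) div m\<close> is \<open>-1/m\<close> modulo \<open>p\<close>, a member \<open>j\<close> satisfies \<open>(-j/m)^m = 1\<close>.\<close>
lemma fixed_pts_imp_dvd:
  assumes "prime p" "m dvd p - 1" "j \<in> fixed_pts p m"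
  shows "int p dvd (- int j) ^ m - int m ^ m"
proof -
  have p1: "p > 1" using assms(1) prime_gt_1_nat by blast
  define e where "e = (p - 1) div m"
  have em: "int e * int m = int p - 1" using assms(2) p1
    by (metis e_def dvd_div_mult_self int_ops(2) of_nat_diff of_nat_mult less_imp_le)
  have "[(e * j) ^ m = 1] (mod p)" using assms(3) by (simp add: fixed_pts_def e_def)
  hence "[int ((e * j) ^ m) = int 1] (mod int p)" by (simp only: cong_int_iff)
  hence "[(int e * int j) ^ m = 1] (mod int p)" by simp
  hence "[(int e * int j) ^ m * int m ^ m = 1 * int m ^ m] (mod int p)" by (rule cong_scalar_right)
  moreover have "(int e * int j) ^ m * int m ^ m = ((int p - 1) * int j) ^ m"
    by (simp only: em[symmetric] power_mult_distrib mult_ac)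
  \<comment> \<open>Here \<open>p - 1\<close> is replaced by \<open>- 1\<close> modulo
    \<open>p\<close>.\<close>
  moreover have "[((int p - 1) * int j) ^ m = (- int j) ^ m] (mod int p)"
    by (intro cong_pow) (simp add: Cong.cong_iff_dvd_diff algebra_simps)
  ultimately have "[(- int j) ^ m = int m ^ m] (mod int p)" using cong_trans cong_sym by (metis mult_1)
  thus ?thesis by (simp add: Cong.cong_iff_dvd_diff)
qed

text \<open>Equal absolute values force \<open>j = m\<close>, hence \<open>m = 1\<close> by
  coprimality, and then the difference is -2.\<close>

lemma neg_power_diff_neq_0:
  assumes "1 \<le> j" "j \<le> m" "coprime j m"
  shows "(- int j) ^ m - int m ^ m \<noteq> 0"
proof
  assume "(- int j) ^ m - int m ^ m = 0"
  hence eq: "(- int j) ^ m = int m ^ m" by simp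
  hence "\<bar>(- int j) ^ m\<bar> = \<bar>int m ^ m\<bar>" by simp
  hence "int j ^ m = int m ^ m" by (simp add: power_abs)
  hence "j = m" using assms(1,2) by (metis of_nat_0_le_iff of_nat_eq_iff power_eq_imp_eq_base order_less_le_trans zero_less_one less_numeral_extra(1))
  hence "m = 1" using assms(3) by simp
  with \<open>j = m\<close> eq show False by simp
qed

lemma card_prime_divisors_le:
  assumes "n > 0"
  shows "real (card {p. prime p \<and> p dvd n}) \<le> log 2 (real n)"
proof -
  have "{p. prime p \<and> p dvd n} = prime_factors n" using assms by (auto simp: in_prime_factors_iff)
  moreover have "divisor_count n \<le> n"
  proof -
    have "{k. k dvd n} \<subseteq> {1..n}"
    proof
      fix k assume "k \<in> {k. k dvd n}"
      hence "k \<le> n" "0 < k" using assms by (auto intro: dvd_imp_le dvd_pos_nat)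
      thus "k \<in> {1..n}" by simp
    qed
    hence "card {k. k dvd n} \<le> card {1..n}" by (intro card_mono) auto
    thus ?thesis by (simp add: divisor_count_def)
  qed
  ultimately have "2 ^ card {p. prime p \<and> p dvd n} \<le> n"
    using two_power_card_prime_factors_le[OF assms] by simp
  hence "2 powr real (card {p. prime p \<and> p dvd n}) \<le> real n"
    by (simp add: powr_realpow)
  thus ?thesis using assms by (simp add: le_log_iff)
qed

text \<open>These are the primes up to \<open>x\<close> for which the assumption of
  \<open>fixed_pts_error\<close> on small \<open>m\<close> fails for some divisor of
  \<open>p - 1\<close>.\<close>

definition exceptional_primes :: "real \<Rightarrow> nat set" where
  "exceptional_primes x = {p. prime p \<and> real p \<le> x \<and>
     (\<exists>m. m dvd p - 1 \<and> real m \<le> real p powr 0.3 \<and> fixed_pts p m \<noteq> {})}"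

lemma finite_primes_le: "finite {p::nat. prime p \<and> real p \<le> x}"
  by (rule finite_subset[of _ "{..nat \<lfloor>x\<rfloor>}"]) (auto simp: le_nat_floor)

text \<open>An exceptional prime divides one of at most \<open>M * M\<close> nonzero integers,
  indexed by \<open>m\<close> and \<open>j\<close>, of absolute value at most
  \<open>2 * m ^ m\<close>. Each has at most \<open>1 + m * log 2 m\<close> prime divisors.\<close>

lemma card_exceptional_primes_le:
  assumes "x \<ge> 1"
  shows "real (card (exceptional_primes x)) \<le> (x powr 0.3)\<^sup>2 * (1 + x powr 0.3 * log 2 x)"
proof -
  define M where "M = nat \<lfloor>x powr 0.3\<rfloor>"
  have Mx: "real M \<le> x powr 0.3" unfolding M_def by (intro of_nat_floor) simp
  define J :: "nat \<Rightarrow> nat set" where "J = (\<lambda>m. {j \<in> {1..m}. coprime j m})"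
  define n where "n = (\<lambda>m j. nat \<bar>(- int j) ^ m - int m ^ m\<bar>)"
  define PD where "PD = (\<lambda>m j. {p. prime p \<and> p dvd n m j})"
  have n0: "n m j > 0" if "j \<in> J m" for m j :: nat
    using neg_power_diff_neq_0[of j m] that by (auto simp: n_def J_def)
  have fin: "finite (PD m j)" if "j \<in> J m" for m j :: nat
    using n0[OF that] by (intro finite_subset[OF _ finite_divisors_nat[of "n m j"]]) (auto simp: PD_def)
  have "exceptional_primes x \<subseteq> (\<Union>m\<in>{1..M}. \<Union>j\<in>J m. PD m j)"
  proof
    fix p assume "p \<in> exceptional_primes x"
    then obtain m j where p: "prime p" "real p \<le> x" "m dvd p - 1" "real m \<le> real p powr 0.3" "j \<in> fixed_pts p m"
      by (auto simp: exceptional_primes_def)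
    have p1: "p > 1" using p(1) prime_gt_1_nat by blast
    have "m > 0" using p(3) p1 by (intro Nat.gr0I) auto
    have "real p powr 0.3 \<le> x powr 0.3" using p(2) by (intro powr_mono2) auto
    hence "m \<le> M" using p(4) unfolding M_def by (intro le_nat_floor) linarith
    moreover have "j \<in> J m" using p(5) by (auto simp: J_def fixed_pts_def)
    moreover have "int p dvd int (n m j)" using fixed_pts_imp_dvd[OF p(1,3,5)] by (simp add: n_def)
    hence "p \<in> PD m j" using p(1) by (simp add: PD_def)
    ultimately show "p \<in> (\<Union>m\<in>{1..M}. \<Union>j\<in>J m. PD m j)" using \<open>m > 0\<close> by (auto simp: Suc_le_eq)
  qed
  hence "card (exceptional_primes x) \<le> card (\<Union>m\<in>{1..M}. \<Union>j\<in>J m. PD m j)"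
    using fin by (intro card_mono finite_UN_I) (auto simp: J_def)
  also have "\<dots> \<le> (\<Sum>m\<in>{1..M}. card (\<Union>j\<in>J m. PD m j))" by (rule card_UN_le) simp
  also have "\<dots> \<le> (\<Sum>m\<in>{1..M}. \<Sum>j\<in>J m. card (PD m j))"
    by (intro sum_mono card_UN_le) (auto simp: J_def)
  finally have "real (card (exceptional_primes x)) \<le> (\<Sum>m\<in>{1..M}. \<Sum>j\<in>J m. real (card (PD m j)))"
    by (metis (mono_tags, lifting) of_nat_le_iff of_nat_sum sum.cong)
  also have "\<dots> \<le> (\<Sum>m\<in>{1..M}. \<Sum>j\<in>J m. 1 + x powr 0.3 * log 2 x)"
  proof (intro sum_mono)
    fix m j assume m: "m \<in> {1..M}" and j: "j \<in> J m"
    have "real m \<le> real M" using m by simp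
    hence mx: "real m \<le> x powr 0.3" using Mx by linarith
    have "x powr 0.3 \<le> x powr 1" using assms by (intro powr_mono) auto
    hence mx1: "real m \<le> x" using mx assms by simp
    have "\<bar>(- int j) ^ m - int m ^ m\<bar> \<le> \<bar>(- int j) ^ m\<bar> + \<bar>int m ^ m\<bar>" by (rule abs_triangle_ineq4)
    also have "\<dots> = int j ^ m + int m ^ m" by (simp add: power_abs)
    also have "\<dots> \<le> int m ^ m + int m ^ m" using j by (intro add_mono power_mono) (auto simp: J_def)
    finally have "int (n m j) \<le> 2 * int m ^ m" by (simp add: n_def)
    hence "real_of_int (int (n m j)) \<le> real_of_int (2 * int m ^ m)" by (simp only: of_int_le_iff)
    hence "real (n m j) \<le> 2 * real m ^ m" by simp
    hence "log 2 (real (n m j)) \<le> log 2 (2 * real m ^ m)"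
      using n0[OF j] m by (subst log_le_cancel_iff) auto
    also have "\<dots> = 1 + real m * log 2 (real m)" using m by (simp add: log_mult log_nat_power)
    also have "\<dots> \<le> 1 + x powr 0.3 * log 2 x"
      using m mx mx1 by (intro add_left_mono mult_mono) auto
    finally show "real (card (PD m j)) \<le> 1 + x powr 0.3 * log 2 x"
      using card_prime_divisors_le[OF n0[OF j]] by (simp add: PD_def)
  qed
  also have "\<dots> \<le> (\<Sum>m\<in>{1..M}. \<Sum>j\<in>{1..M}. 1 + x powr 0.3 * log 2 x)"
    using assms by (intro sum_mono sum_mono2) (auto simp: J_def)
  also have "\<dots> = (real M)\<^sup>2 * (1 + x powr 0.3 * log 2 x)" by (simp add: power2_eq_square)
  also have "\<dots> \<le> (x powr 0.3)\<^sup>2 * (1 + x powr 0.3 * log 2 x)"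
    using assms Mx by (intro mult_right_mono power_mono) auto
  finally show ?thesis .
qed

section \<open>Summation over the divisors of \<open>p - 1\<close> and conclusion\<close>

lemma F_error:
  assumes "prime p" "C \<ge> 1" "\<epsilon> > 0"
    and C: "\<And>n. n > 0 \<Longrightarrow> real (divisor_count n) \<le> C * real n powr \<epsilon>"
    and small: "\<And>m. m dvd p - 1 \<Longrightarrow> real m \<le> real p powr 0.3 \<Longrightarrow> fixed_pts p m = {}"
  shows "\<bar>real (F p) - (real p - 1)\<bar> \<le>
    (C * real p powr \<epsilon>) * (10 * (1 + ln (real p)) * real p powr 0.825 * (C * real p powr (3 * \<epsilon>)))"
proof -
  have p1: "p > 1" using assms(1) prime_gt_1_nat by blast
  define R where "R = 10 * (1 + ln (real p)) * real p powr 0.825 * (C * real p powr (3 * \<epsilon>))"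
  have R0: "R \<ge> 0" using p1 assms(2) by (simp add: R_def)
  \<comment> \<open>The totients of the divisors add up to \<open>p - 1\<close>, so the error splits
    into one term for each divisor.\<close>
  have "real p - 1 = real (\<Sum>m | m dvd p - 1. totient m)"
    unfolding totient_divisor_sum using p1 by (simp add: of_nat_diff)
  hence "real (F p) - (real p - 1) =
    (\<Sum>m | m dvd p - 1. real ((p - 1) div m * card (fixed_pts p m)) - real (totient m))"
    unfolding F_eq_sum_divisors[OF assms(1)] by (simp add: sum_subtractf)
  also have "\<bar>\<dots>\<bar> \<le> (\<Sum>m | m dvd p - 1. \<bar>real ((p - 1) div m * card (fixed_pts p m)) - real (totient m)\<bar>)"
    by (rule sum_abs)
  also have "\<dots> \<le> (\<Sum>m | m dvd p - 1. R)"
    unfolding R_def using assms by (intro sum_mono fixed_pts_error) auto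
  also have "\<dots> = real (divisor_count (p - 1)) * R" by (simp add: divisor_count_def)
  also have "\<dots> \<le> (C * real p powr \<epsilon>) * R"
  proof (rule mult_right_mono[OF _ R0])
    have "real (divisor_count (p - 1)) \<le> C * real (p - 1) powr \<epsilon>" using p1 by (intro C) auto
    also have "\<dots> \<le> C * real p powr \<epsilon>" using assms(2,3) by (intro mult_left_mono powr_mono2) auto
    finally show "real (divisor_count (p - 1)) \<le> C * real p powr \<epsilon>" .
  qed
  finally show ?thesis by (simp only: R_def)
qed

lemma F_error_eventually:
  "\<exists>p0::nat. \<forall>p\<ge>p0. prime p \<longrightarrow> (\<forall>m. m dvd p - 1 \<longrightarrow> real m \<le> real p powr 0.3 \<longrightarrow> fixed_pts p m = {}) \<longrightarrow>
     \<bar>real (F p) - (real p - 1)\<bar> \<le> real p powr 0.8313"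
proof -
  \<comment> \<open>With \<open>\<epsilon> = 1/1000\<close> the total exponent is
    \<open>0.825 + 0.001 + 0.003 = 0.829\<close>; the gap to 0.8313 absorbs the logarithm and the
    constants.\<close>
  obtain C where C: "C \<ge> 1" "\<And>n. n > 0 \<Longrightarrow> real (divisor_count n) \<le> C * real n powr (1 / 1000)"
    using divisor_count_le_powr[of "1 / 1000"] by auto
  have "eventually (\<lambda>x. (C * x powr (1 / 1000)) *
      (10 * (1 + ln x) * x powr 0.825 * (C * x powr (3 * (1 / 1000)))) \<le> x powr 0.8313) at_top"
    using C(1) by real_asymp
  hence "eventually (\<lambda>p. (C * real p powr (1 / 1000)) *
      (10 * (1 + ln (real p)) * real p powr 0.825 * (C * real p powr (3 * (1 / 1000)))) \<le> real p powr 0.8313) at_top"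
    by (rule eventually_compose_filterlim) (rule filterlim_real_sequentially)
  then obtain p0 where "\<And>p. p \<ge> p0 \<Longrightarrow> (C * real p powr (1 / 1000)) *
      (10 * (1 + ln (real p)) * real p powr 0.825 * (C * real p powr (3 * (1 / 1000)))) \<le> real p powr 0.8313"
    unfolding eventually_at_top_linorder by blast
  thus ?thesis using F_error[OF _ C(1) _ C(2)] by (intro exI[of _ p0]) (meson order_trans zero_less_divide_1_iff zero_less_numeral)
qed

lemma many_primes_small_F_error:
  "\<exists>x0::real. \<forall>x\<ge>x0. real (card {p. prime p \<and> real p \<le> x \<and> \<bar>real (F p) - (real p - 1)\<bar> \<le> real p powr 0.8313})
      \<ge> 1 / 16 * x / ln x"
proof -
  obtain p0 where p0: "\<And>p. p \<ge> p0 \<Longrightarrow> prime p \<Longrightarrow>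
      (\<And>m. m dvd p - 1 \<Longrightarrow> real m \<le> real p powr 0.3 \<Longrightarrow> fixed_pts p m = {}) \<Longrightarrow>
     \<bar>real (F p) - (real p - 1)\<bar> \<le> real p powr 0.8313"
    using F_error_eventually by blast
  \<comment> \<open>The exceptional primes number \<open>O(x powr 0.9 * ln x)\<close> and those
    below \<open>p0\<close> are bounded in number, so half of Chebyshev's lower bound
    survives.\<close>
  have "eventually (\<lambda>x::real. x / (8 * ln x) - (x powr 0.3)\<^sup>2 * (1 + x powr 0.3 * log 2 x) - real p0 \<ge> 1 / 16 * x / ln x) at_top"
    by real_asymp
  moreover have "eventually (\<lambda>x::real. x \<ge> 2) at_top" by (rule eventually_ge_at_top)
  ultimately have "eventually (\<lambda>x. real (card {p. prime p \<and> real p \<le> x \<and>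
      \<bar>real (F p) - (real p - 1)\<bar> \<le> real p powr 0.8313}) \<ge> 1 / 16 * x / ln x) at_top"
  proof eventually_elim
    case (elim x)
    define S where "S = {p. prime p \<and> real p \<le> x \<and> \<bar>real (F p) - (real p - 1)\<bar> \<le> real p powr 0.8313}"
    have fin: "finite S" "finite (exceptional_primes x)"
      by (rule finite_subset[OF _ finite_primes_le[of x]]; force simp: S_def exceptional_primes_def)+
    have "{p. prime p \<and> real p \<le> x} \<subseteq> S \<union> exceptional_primes x \<union> {..<p0}"
    proof
      fix p assume p: "p \<in> {p. prime p \<and> real p \<le> x}"
      show "p \<in> S \<union> exceptional_primes x \<union> {..<p0}"
      proof (cases "p \<ge> p0 \<and> p \<notin> exceptional_primes x")
        case True
        hence "\<bar>real (F p) - (real p - 1)\<bar> \<le> real p powr 0.8313"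
          using p by (intro p0) (auto simp: exceptional_primes_def)
        thus ?thesis using p by (simp add: S_def)
      qed auto
    qed
    hence "card {p. prime p \<and> real p \<le> x} \<le> card (S \<union> exceptional_primes x \<union> {..<p0})"
      using fin by (intro card_mono) auto
    also have "\<dots> \<le> card S + card (exceptional_primes x) + p0"
      using card_Un_le[of "S \<union> exceptional_primes x" "{..<p0}"] card_Un_le[of S "exceptional_primes x"] by simp
    finally have "x / (8 * ln x) \<le> real (card S) + real (card (exceptional_primes x)) + real p0"
      using chebyshev_lower[of x] elim(2) by linarith
    thus ?case using card_exceptional_primes_le[of x] elim unfolding S_def by linarith
  qed
  thus ?thesis unfolding eventually_at_top_linorder by blast
qed

theorem theorem3:
  "(\<exists>C::real. \<exists>c::real. \<exists>x0::real. c > 0 \<and>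
      (\<forall>x::real. x \<ge> x0 \<longrightarrow>
        real (card {p::nat. prime p \<and> real p \<le> x \<and>
                \<bar>real (F p) - (real p - 1)\<bar> \<le> C * real p powr (5/6)})
          \<ge> c * x / ln x)) \<and>
   (\<exists>c::real. \<exists>x0::real. c > 0 \<and>
      (\<forall>x::real. x \<ge> x0 \<longrightarrow>
        real (card {p::nat. prime p \<and> real p \<le> x \<and>
                \<bar>real (F p) - (real p - 1)\<bar>
                  \<le> real p powr 0.8313 * real (divisor_count (p - 1)) ^ 2 * (2 + ln (real p))})
          \<ge> c * x / ln x))"
proof -
  obtain x0 :: real where x0: "\<And>x. x \<ge> x0 \<Longrightarrow> 1 / 16 * x / ln x \<le> real (card {p. prime p \<and> real p \<le> x \<and>
      \<bar>real (F p) - (real p - 1)\<bar> \<le> real p powr 0.8313})"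
    using many_primes_small_F_error by blast
  \<comment> \<open>Both claims follow from the bound \<open>p powr 0.8313\<close>, since enlarging
    the permitted error only adds primes.\<close>
  have weaken: "1 / 16 * x / ln x \<le> real (card {p. prime p \<and> real p \<le> x \<and> \<bar>real (F p) - (real p - 1)\<bar> \<le> f p})"
    if "x \<ge> x0" and f: "\<And>p. prime p \<Longrightarrow> real p powr 0.8313 \<le> f p" for f :: "nat \<Rightarrow> real" and x
  proof -
    have "card {p. prime p \<and> real p \<le> x \<and> \<bar>real (F p) - (real p - 1)\<bar> \<le> real p powr 0.8313} \<le>
          card {p. prime p \<and> real p \<le> x \<and> \<bar>real (F p) - (real p - 1)\<bar> \<le> f p}"
    proof (rule card_mono)
      show "finite {p. prime p \<and> real p \<le> x \<and> \<bar>real (F p) - (real p - 1)\<bar> \<le> f p}"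
        by (rule finite_subset[OF _ finite_primes_le[of x]]) auto
    qed (use f order_trans in blast)
    thus ?thesis using x0[OF that(1)] by linarith
  qed
  \<comment> \<open>As 0.8313 is below 5/6, the constant \<open>C = 1\<close> serves in the first
    claim.\<close>
  have "real p powr 0.8313 \<le> 1 * real p powr (5/6)" if "prime p" for p :: nat
    using prime_gt_1_nat[OF that] by (simp add: powr_mono)
  moreover have "real p powr 0.8313 \<le> real p powr 0.8313 * real (divisor_count (p - 1)) ^ 2 * (2 + ln (real p))"
    if "prime p" for p :: nat
  proof -
    have p1: "p > 1" using that prime_gt_1_nat by blast
    have "1 \<le> real (divisor_count (p - 1))" using divisor_count_pos[of "p - 1"] p1 by simp
    hence "1 ^ 2 * 1 \<le> real (divisor_count (p - 1)) ^ 2 * (2 + ln (real p))"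
      using p1 by (intro mult_mono power_mono) auto
    hence "real p powr 0.8313 * 1 \<le> real p powr 0.8313 * (real (divisor_count (p - 1)) ^ 2 * (2 + ln (real p)))"
      by (intro mult_left_mono) auto
    thus ?thesis by (simp add: mult.assoc)
  qed
  ultimately show ?thesis
    using weaken[where f = "\<lambda>p. 1 * real p powr (5/6)"]
      weaken[where f = "\<lambda>p. real p powr 0.8313 * real (divisor_count (p - 1)) ^ 2 * (2 + ln (real p))"]
      zero_less_divide_iff[of 1 "16 :: real"] zero_less_one zero_less_numeral by meson
qed

end
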